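(* Let $n\ge 1$, let $L$ be a real symmetric $n\times n$ matrix, let $C_1,C_2$ be real symmetric positive definite $n\times n$ matrices and let $K_1,K_2$ be real symmetric positive semidefinite $n\times n$ matrices. Then the real-valued function \[ z \;\mapsto\; \operatorname{tr}\exp\Big( L + \log(C_1 + zK_1) + \log(C_2 - zK_2)\Big), \] defined for real $z$ in a neighborhood of $0$ (where $C_1+zK_1$ and $C_2-zK_2$ are positive definite), is concave on some neighborhood of $0$.
   Context: For a real symmetric positive definite matrix $C$, $\log C$ denotes the matrix logarithm (the unique real symmetric matrix $H$ with $\exp H = C$), and $\exp$ is the matrix exponential; $\operatorname{tr}$ is the trace. *)

theory Defs
  imports "HOL-Analysis.Analysis"
begin

text \<open>Real n x n matrices are rendered as real^'n^'n with 'n a finite type (n = CARD('n) \<ge> 1).\<close>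

definition symmetric_mat :: "real^'n^'n \<Rightarrow> bool" where
  "symmetric_mat A \<longleftrightarrow> transpose A = A"

definition pos_def_mat :: "real^'n^'n \<Rightarrow> bool" where
  "pos_def_mat A \<longleftrightarrow> symmetric_mat A \<and> (\<forall>x. x \<noteq> 0 \<longrightarrow> x \<bullet> (A *v x) > 0)"

definition pos_semidef_mat :: "real^'n^'n \<Rightarrow> bool" where
  "pos_semidef_mat A \<longleftrightarrow> symmetric_mat A \<and> (\<forall>x. x \<bullet> (A *v x) \<ge> 0)"

primrec mat_pow :: "real^'n^'n \<Rightarrow> nat \<Rightarrow> real^'n^'n" where
  "mat_pow A 0 = mat 1"
| "mat_pow A (Suc k) = A ** mat_pow A k"

definition mat_exp :: "real^'n^'n \<Rightarrow> real^'n^'n" where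
  "mat_exp A = (\<Sum>k. (1 / fact k) *\<^sub>R mat_pow A k)"

definition mat_log :: "real^'n^'n \<Rightarrow> real^'n^'n" where
  "mat_log C = (THE H. symmetric_mat H \<and> mat_exp H = C)"

end

theory Submission
  imports Defs "HOL-Complex_Analysis.Conformal_Mappings"
    "HOL-Computational_Algebra.Fundamental_Theorem_Algebra"
begin

text \<open>
  The argument is complex-analytic, in the style of Epstein's proof of Lieb's concavity theorem.
  The function extends to
  \<open>F z = tr exp (L + log (C\<^sub>1 + z K\<^sub>1) + log (C\<^sub>2 - z K\<^sub>2))\<close>, holomorphic on the upper half plane and near \<open>0\<close>.
  For \<open>Im z > 0\<close> the logarithms of \<open>K\<^sub>1 + C\<^sub>1 / z\<close> and of \<open>C\<^sub>2 - z K\<^sub>2\<close> have numerical range in the lower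
  half plane, those of \<open>C\<^sub>1 + z K\<^sub>1\<close> and of \<open>K\<^sub>2 - C\<^sub>2 / z\<close> in the upper half plane. As
  \<open>log (C\<^sub>1 + z K\<^sub>1) = log z + log (K\<^sub>1 + C\<^sub>1 / z)\<close>, and similarly for the second term, every eigenvalue \<open>\<mu>\<close>
  of the exponent satisfies \<open>-\<pi> \<le> Im (\<mu> - log z) \<le> 0\<close>, so \<open>Im (F z / z) \<le> 0\<close>.
  By the maximum principle \<open>(F z - F 0) / z\<close> also has nonpositive imaginary part on the upper half plane;
  it is real on the real axis near \<open>0\<close>, hence its derivative \<open>F'' 0 / 2\<close> at \<open>0\<close> is nonpositive.
  Replacing \<open>C\<^sub>1, C\<^sub>2\<close> by \<open>C\<^sub>1 + x K\<^sub>1, C\<^sub>2 - x K\<^sub>2\<close> gives \<open>F'' x \<le> 0\<close> for all small real \<open>x\<close>.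
\<close>

subsection \<open>Eigenvectors of symmetric matrices\<close>

lemma symmetric_mat_inner: "symmetric_mat A \<Longrightarrow> (A *v x) \<bullet> y = x \<bullet> (A *v y)"
  by (simp add: symmetric_mat_def dot_lmul_matrix flip: vector_transpose_matrix)

text \<open>A nonzero linear term would dominate the quadratic one near \<open>t = 0\<close>. This
  converts maximality of a quadratic form into a vanishing first variation.\<close>

lemma linear_coeff_zero_of_quadratic_nonpos:
  fixes a b :: real
  assumes "\<And>t. t * a + t\<^sup>2 * b \<le> 0"
  shows "a = 0"
proof (rule ccontr)
  assume a: "a \<noteq> 0"
  \<comment> \<open>The factor \<open>1 / d\<close> is small enough that the quadratic term cannot
    cancel the linear one: with \<open>d + b > 0\<close> the value at \<open>t = a / d\<close> is
    positive.\<close>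
  define d where "d = \<bar>b\<bar> + 1"
  define t where "t = a / d"
  have d: "d > 0" "d + b > 0" by (auto simp: d_def)
  have "t * a + t\<^sup>2 * b = a\<^sup>2 / d\<^sup>2 * (d + b)"
    using d by (simp add: t_def field_simps power2_eq_square)
  then have "t * a + t\<^sup>2 * b > 0" using a d by simp
  then show False using assms[of t] by linarith
qed

text \<open>If the eigenvectors did not span, their orthogonal complement \<open>W\<close> would be
  nonzero and, by symmetry, invariant under \<open>A\<close>. A maximizer of the quadratic form on
  the unit sphere of \<open>W\<close> is an eigenvector, hence orthogonal to itself.\<close>

lemma symmetric_mat_eigenvectors_span:
  fixes A :: "real^'n^'n"
  assumes A: "symmetric_mat A"
  shows "span {v. \<exists>c. A *v v = c *\<^sub>R v} = UNIV"
proof (rule ccontr)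
  define E where "E = {v. \<exists>c. A *v v = c *\<^sub>R v}"
  assume "span {v. \<exists>c. A *v v = c *\<^sub>R v} \<noteq> UNIV"
  then have "span E \<noteq> UNIV" by (simp add: E_def)
  then obtain a where a: "a \<noteq> 0" "\<And>x. x \<in> span E \<Longrightarrow> a \<bullet> x = 0"
    using span_not_UNIV_orthogonal by blast
  define W where "W = {w. \<forall>x\<in>E. w \<bullet> x = 0}"
  have W: "subspace W" by (auto simp: W_def subspace_def inner_add_left)
  have closedW: "closed W"
    by (rule closed_subspace[OF W])
  have aW: "a \<in> W" using a by (auto simp: W_def span_base)
  have invW: "A *v w \<in> W" if "w \<in> W" for w
    using that by (auto simp: W_def E_def symmetric_mat_inner[OF A])
  have "compact (sphere 0 1 \<inter> W)" using closedW by (simp add: compact_Int_closed)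
  moreover have "(1 / norm a) *\<^sub>R a \<in> sphere 0 1 \<inter> W"
    using a aW W by (auto simp: subspace_scale)
  moreover have "continuous_on (sphere 0 1 \<inter> W) (\<lambda>x. x \<bullet> (A *v x))"
    by (intro continuous_on_inner continuous_on_id linear_continuous_on matrix_vector_mul_bounded_linear)
  ultimately obtain v where v: "v \<in> sphere 0 1 \<inter> W"
    and vmax: "\<And>y. y \<in> sphere 0 1 \<inter> W \<Longrightarrow> y \<bullet> (A *v y) \<le> v \<bullet> (A *v v)"
    using continuous_attains_sup[of "sphere 0 1 \<inter> W" "\<lambda>x. x \<bullet> (A *v x)"] by blast
  define c where "c = v \<bullet> (A *v v)"
  have vv: "v \<bullet> v = 1" and vW: "v \<in> W" using v by (auto simp: norm_eq_1)
  have quad: "y \<bullet> (A *v y) \<le> c * (y \<bullet> y)" if y: "y \<in> W" for y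
  proof (cases "y = 0")
    case False
    define u where "u = (1 / norm y) *\<^sub>R y"
    have "u \<bullet> (A *v u) \<le> c" unfolding c_def
      using False y W by (intro vmax) (auto simp: u_def subspace_scale)
    moreover have "u \<bullet> (A *v u) = (y \<bullet> (A *v y)) / (y \<bullet> y)"
      by (simp add: u_def matrix_vector_mult_scaleR power2_norm_eq_inner[symmetric] power2_eq_square)
    ultimately show ?thesis using False by (simp add: field_simps)
  qed simp
  have "(A *v v - c *\<^sub>R v) \<bullet> h = 0" if h: "h \<in> W" for h
  proof -
    \<comment> \<open>The bound \<open>quad\<close> at \<open>v + t h\<close>, where equality holds
      at \<open>t = 0\<close>; its linear coefficient is the first variation of the form in
      direction \<open>h\<close>.\<close>
    have "t * (2 * ((A *v v - c *\<^sub>R v) \<bullet> h)) + t\<^sup>2 * (h \<bullet> (A *v h) - c * (h \<bullet> h)) \<le> 0" for t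
    proof -
      have le: "(v + t *\<^sub>R h) \<bullet> (A *v (v + t *\<^sub>R h)) \<le> c * ((v + t *\<^sub>R h) \<bullet> (v + t *\<^sub>R h))"
        using vW h W by (intro quad) (auto simp: subspace_add subspace_scale)
      have e1: "(v + t *\<^sub>R h) \<bullet> (A *v (v + t *\<^sub>R h)) = c + 2 * t * ((A *v v) \<bullet> h) + t\<^sup>2 * (h \<bullet> (A *v h))"
        using symmetric_mat_inner[OF A, of v h]
        by (simp add: matrix_vector_right_distrib matrix_vector_mult_scaleR inner_add_left inner_add_right
            c_def power2_eq_square algebra_simps inner_commute[of h "A *v v"])
      have e2: "(v + t *\<^sub>R h) \<bullet> (v + t *\<^sub>R h) = 1 + 2 * t * (v \<bullet> h) + t\<^sup>2 * (h \<bullet> h)"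
        using vv by (simp add: inner_add_left inner_add_right power2_eq_square algebra_simps inner_commute[of h v])
      from le show ?thesis unfolding e1 e2 by (simp add: inner_diff_left algebra_simps)
    qed
    then have "2 * ((A *v v - c *\<^sub>R v) \<bullet> h) = 0" by (rule linear_coeff_zero_of_quadratic_nonpos)
    then show ?thesis by simp
  qed
  moreover have "A *v v - c *\<^sub>R v \<in> W"
    using vW W invW by (auto intro!: subspace_diff subspace_scale)
  ultimately have "A *v v - c *\<^sub>R v = 0" using inner_eq_zero_iff by blast
  then have "v \<in> E" by (auto simp: E_def)
  then have "v \<bullet> v = 0" using vW by (auto simp: W_def)
  then show False using vv by simp
qed

subsection \<open>Traces of powers and eigenvalues\<close>

text \<open>The vector \<open>q(Z) w\<close>, computed by Horner's scheme on the coefficients of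
  \<open>q\<close>.\<close>

definition poly_vec :: "complex^'n^'n \<Rightarrow> complex^'n \<Rightarrow> complex poly \<Rightarrow> complex^'n" where
  "poly_vec Z w q = fold_coeffs (\<lambda>a u. a *s w + Z *v u) q 0"

lemma poly_vec_0 [simp]: "poly_vec Z w 0 = 0"
  by (simp add: poly_vec_def)

lemma poly_vec_pCons [simp]: "poly_vec Z w (pCons a q) = a *s w + Z *v poly_vec Z w q"
  by (cases "q = 0 \<and> a = 0") (auto simp: poly_vec_def)

lemma poly_vec_add [simp]: "poly_vec Z w (p + q) = poly_vec Z w p + poly_vec Z w q"
  by (induction p q rule: poly_induct2) (simp_all add: vec.scale_left_distrib matrix_vector_right_distrib)

lemma poly_vec_smult [simp]: "poly_vec Z w (smult c p) = c *s poly_vec Z w p"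
  by (induction p) (simp_all add: vec.scale_right_distrib vector_scalar_commute)

lemma poly_vec_sum: "poly_vec Z w (sum f A) = (\<Sum>i\<in>A. poly_vec Z w (f i))"
  by (induction A rule: infinite_finite_induct) simp_all

text \<open>The \<open>n + 1\<close> vectors \<open>w, Z w, ..., Z^n w\<close> are linearly
  dependent in dimension \<open>n\<close>, and a dependence is a polynomial.\<close>

lemma exists_annihilating_poly:
  fixes Z :: "complex^'n^'n"
  shows "\<exists>q. q \<noteq> 0 \<and> poly_vec Z w q = 0"
proof -
  define x where "x i = poly_vec Z w (monom 1 i)" for i
  define n where "n = CARD('n)"
  show ?thesis
  \<comment> \<open>Dependence is a notion for sets, so coinciding vectors are treated first: then a
    difference of two monomials annihilates \<open>w\<close>.\<close>
  proof (cases "inj_on x {..n}")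
    case False
    then obtain i j where ij: "i \<noteq> j" "x i = x j" by (auto simp: inj_on_def)
    define q where "q = monom 1 i + smult (-1) (monom (1::complex) j)"
    have "coeff q i = 1" using ij by (simp add: q_def)
    then have "q \<noteq> 0" by force
    moreover have "poly_vec Z w q = 0"
      unfolding q_def poly_vec_add poly_vec_smult using ij by (simp add: x_def[symmetric])
    ultimately show ?thesis by blast
  next
    case True
    then have card: "card (x ` {..n}) = Suc n" by (simp add: card_image)
    have "vec.dependent (x ` {..n})"
    proof (rule ccontr)
      assume "\<not> ?thesis"
      then have "card (x ` {..n}) \<le> vec.dim (UNIV :: (complex^'n) set)"
        by (intro vec.independent_card_le_dim) auto
      then show False using card unfolding vec_dim_card n_def by simp
    qed
    then obtain u v where u: "(\<Sum>v\<in>x ` {..n}. u v *s v) = 0" and v: "v \<in> x ` {..n}" "u v \<noteq> 0"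
      using vec.dependent_finite[of "x ` {..n}"] by auto
    obtain k where k: "k \<le> n" "v = x k" using v by auto
    define q where "q = (\<Sum>i\<le>n. smult (u (x i)) (monom 1 i))"
    have "coeff q k = (\<Sum>i\<le>n. if i = k then u (x i) else 0)"
      unfolding q_def coeff_sum by (intro sum.cong) auto
    also have "\<dots> = u v" using k by (simp add: sum.delta)
    finally have "q \<noteq> 0" using v by force
    moreover have "poly_vec Z w q = (\<Sum>v\<in>x ` {..n}. u v *s v)"
      by (simp add: q_def poly_vec_sum x_def[symmetric] sum.reindex[OF True])
    ultimately show ?thesis using u by auto
  qed
qed

text \<open>Let \<open>q\<close> have minimal degree among nonzero polynomials with
  \<open>q(Z) w = 0\<close>, and split off a root \<open>c\<close>, so that
  \<open>q = (X - c) r\<close>. By minimality \<open>r(Z) w\<close> is nonzero, and it is an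
  eigenvector for \<open>c\<close>. Starting from a coordinate vector in \<open>S\<close>, all
  \<open>Z^k w\<close> stay supported in \<open>S\<close>.\<close>

lemma exists_eigenvector_supported:
  fixes Z :: "complex^'n^'n"
  assumes S: "S \<noteq> {}" and Z: "\<And>i j. i \<notin> S \<Longrightarrow> Z $ i $ j = 0"
  shows "\<exists>v c. v \<noteq> 0 \<and> (\<forall>i. i \<notin> S \<longrightarrow> v $ i = 0) \<and> Z *v v = c *s v"
proof -
  obtain p where p: "p \<in> S" using S by blast
  define w :: "complex^'n" where "w = axis p 1"
  have w: "w \<noteq> 0" by (simp add: w_def axis_eq_0_iff)
  define Q where "Q q \<longleftrightarrow> q \<noteq> 0 \<and> poly_vec Z w q = 0" for q
  obtain q where q: "Q q" and qmin: "\<And>r. Q r \<Longrightarrow> degree q \<le> degree r"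
    using exists_annihilating_poly[of Z w] ex_has_least_nat[of Q _ degree] unfolding Q_def by blast
  have "degree q \<noteq> 0"
  proof
    assume "degree q = 0"
    then obtain a where "q = [:a:]" using degree_eq_zeroE by blast
    then show False using q w by (auto simp: Q_def)
  qed
  then obtain c where "poly q c = 0"
    using Fundamental_Theorem_Algebra.fundamental_theorem_of_algebra[of q] by (auto simp: constant_degree)
  then obtain r where r: "q = [:- c, 1:] * r" using poly_eq_0_iff_dvd by (metis dvdE)
  have r0: "r \<noteq> 0" using q r by (auto simp: Q_def)
  have "degree q = Suc (degree r)" unfolding r using r0 by (subst degree_mult_eq) auto
  then have rv: "poly_vec Z w r \<noteq> 0" using qmin[of r] r0 by (auto simp: Q_def)
  have "q = smult (- c) r + pCons 0 r" unfolding r by simp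
  then have "poly_vec Z w q = (- c) *s poly_vec Z w r + Z *v poly_vec Z w r"
    by (simp only: poly_vec_add poly_vec_smult poly_vec_pCons) simp
  then have eig: "Z *v poly_vec Z w r = c *s poly_vec Z w r"
    using q by (simp add: Q_def vec.scale_minus_left)
  have "\<forall>i. i \<notin> S \<longrightarrow> poly_vec Z w r $ i = 0" for r
    by (induction r) (use p Z in \<open>auto simp: w_def axis_def matrix_vector_mult_def\<close>)
  then show ?thesis using rv eig by blast
qed

section \<open>Matrix powers, similarity and deflation\<close>

text \<open>Polymorphic in the entries, so that real powers can be compared with complex
  ones.\<close>

primrec mpow :: "'a::semiring_1^'n^'n \<Rightarrow> nat \<Rightarrow> 'a^'n^'n" where
  "mpow A 0 = mat 1"
| "mpow A (Suc k) = A ** mpow A k"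

lemma mpow_similar:
  fixes A :: "'a::comm_ring_1^'n^'n"
  assumes "T ** U = mat 1"
  shows "mpow (U ** A ** T) k ** U = U ** mpow A k"
proof (induction k)
  case (Suc k)
  have "mpow (U ** A ** T) (Suc k) ** U = (U ** A ** T) ** (mpow (U ** A ** T) k ** U)"
    by (simp add: matrix_mul_assoc)
  also have "\<dots> = U ** A ** (T ** U) ** mpow A k" using Suc by (simp add: matrix_mul_assoc)
  finally show ?case using assms by (simp add: matrix_mul_assoc)
qed simp

lemma trace_mpow_similar:
  fixes A :: "'a::comm_ring_1^'n^'n"
  assumes "T ** U = mat 1" "U ** T = mat 1"
  shows "trace (mpow (U ** A ** T) k) = trace (mpow A k)"
proof -
  have "mpow (U ** A ** T) k = mpow (U ** A ** T) k ** U ** T"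
    using assms(2) by (simp flip: matrix_mul_assoc)
  also have "\<dots> = U ** mpow A k ** T" by (simp add: mpow_similar[OF assms(1)])
  also have "trace \<dots> = trace (T ** (U ** mpow A k))" by (rule trace_mul_sym)
  also have "T ** (U ** mpow A k) = mpow A k" using assms by (simp add: matrix_mul_assoc)
  finally show ?thesis .
qed

text \<open>Deflation: conjugate an eigenvector onto a coordinate axis, then delete that row and column.
  The matrices keep their size, so the trace of the zeroth power is excluded.\<close>
lemma trace_mpow_eigenvalues_supported:
  fixes Z :: "complex^'n^'n"
  assumes "finite S" "\<And>i j. i \<notin> S \<or> j \<notin> S \<Longrightarrow> Z $ i $ j = 0"
  shows "\<exists>l. (\<forall>i\<in>S. \<exists>v. v \<noteq> 0 \<and> (\<forall>j. j \<notin> S \<longrightarrow> v $ j = 0) \<and> Z *v v = l i *s v) \<and>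
             (\<forall>k. trace (mpow Z (Suc k)) = (\<Sum>i\<in>S. l i ^ Suc k))"
  using assms
proof (induction "card S" arbitrary: S Z)
  case 0
  then have "Z = 0" by (auto simp: vec_eq_iff)
  then show ?case using 0 by (auto simp: trace_def)
next
  case (Suc n)
  have S: "S \<noteq> {}" using Suc by auto
  obtain v0 c where v0: "v0 \<noteq> 0" "\<And>i. i \<notin> S \<Longrightarrow> v0 $ i = 0" "Z *v v0 = c *s v0"
    using exists_eigenvector_supported[OF S, of Z] Suc.prems by blast
  obtain p where p: "v0 $ p \<noteq> 0" using v0 by (auto simp: vec_eq_iff)
  have pS: "p \<in> S" using p v0 by blast
  define v where "v = (1 / v0 $ p) *s v0"
  have v: "v $ p = 1" "\<And>i. i \<notin> S \<Longrightarrow> v $ i = 0" "Z *v v = c *s v"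
    using v0 p by (auto simp: v_def vector_scalar_commute vec_eq_iff)
  \<comment> \<open>\<open>T\<close> sends the axis vector at \<open>p\<close> to \<open>v\<close>
    and fixes the other axis vectors; \<open>U\<close> is its inverse.\<close>
  define T :: "complex^'n^'n" where "T = (\<chi> i j. (if i = j then 1 else 0) + (if j = p \<and> i \<noteq> p then v $ i else 0))"
  define U :: "complex^'n^'n" where "U = (\<chi> i j. (if i = j then 1 else 0) - (if j = p \<and> i \<noteq> p then v $ i else 0))"
  have Tx: "(T *v x) $ i = x $ i + (if i \<noteq> p then v $ i * x $ p else 0)" for x i
    by (simp add: T_def matrix_vector_mult_def distrib_right sum.distrib if_distrib[of "\<lambda>a. a * _"] cong: if_cong)
  have Ux: "(U *v x) $ i = x $ i - (if i \<noteq> p then v $ i * x $ p else 0)" for x i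
    by (simp add: U_def matrix_vector_mult_def left_diff_distrib sum_subtractf if_distrib[of "\<lambda>a. a * _"] cong: if_cong)
  have TU: "T ** U = mat 1"
    by (subst matrix_eq) (simp add: vec_eq_iff Tx Ux flip: matrix_vector_mul_assoc)
  have UT: "U ** T = mat 1"
    by (subst matrix_eq) (simp add: vec_eq_iff Tx Ux flip: matrix_vector_mul_assoc)
  define Y where "Y = U ** Z ** T"
  have Yx: "Y *v x = U *v (Z *v (T *v x))" for x by (simp add: Y_def flip: matrix_vector_mul_assoc)
  have Tp: "T *v axis p 1 = v" using v by (auto simp: vec_eq_iff Tx axis_def)
  have Up: "U *v v = axis p 1" by (metis Tp UT matrix_vector_mul_assoc matrix_vector_mul_lid)
  have Yp: "Y *v axis p 1 = c *s axis p 1" by (simp add: Yx Tp v vector_scalar_commute Up)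
  have col: "M $ i $ j = (M *v axis j 1) $ i" for M :: "complex^'n^'n" and i j
    by (simp add: matrix_vector_mult_def axis_def if_distrib cong: if_cong)
  have Y_supp: "Y $ i $ j = 0" if "i \<notin> S \<or> j \<notin> S" for i j
  proof (cases "i \<in> S")
    case False
    have "(Z *v x) $ i = 0" for x using Suc.prems(2) False by (simp add: matrix_vector_mult_def)
    then show ?thesis using False v(2)[OF False] unfolding col[of Y] by (simp add: Yx Ux)
  next
    case True
    then have j: "j \<notin> S" using that by blast
    then have "j \<noteq> p" using pS by blast
    then have "T *v axis j 1 = axis j 1" by (auto simp: vec_eq_iff Tx axis_def)
    moreover have "Z *v axis j 1 = 0" using Suc.prems(2) j by (simp add: vec_eq_iff flip: col)
    ultimately show ?thesis unfolding col[of Y] by (simp add: Yx)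
  qed
  \<comment> \<open>Column \<open>p\<close> of \<open>Y\<close> is \<open>c\<close> times the axis
    vector, so \<open>Y\<close> is block triangular: away from \<open>p\<close> its powers agree
    with those of \<open>X\<close>, and the entry at \<open>p\<close> contributes
    \<open>c ^ k\<close>.\<close>
  define X :: "complex^'n^'n" where "X = (\<chi> i j. if i = p \<or> j = p then 0 else Y $ i $ j)"
  have "n = card (S - {p})" "finite (S - {p})" using Suc pS by auto
  moreover have "X $ i $ j = 0" if "i \<notin> S - {p} \<or> j \<notin> S - {p}" for i j
    using that Y_supp by (auto simp: X_def)
  ultimately obtain l where l: "\<And>i. i \<in> S - {p} \<Longrightarrow> \<exists>v. v \<noteq> 0 \<and> (\<forall>j. j \<notin> S - {p} \<longrightarrow> v $ j = 0) \<and> X *v v = l i *s v"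
    and ltr: "\<And>k. trace (mpow X (Suc k)) = (\<Sum>i\<in>S - {p}. l i ^ Suc k)"
    using Suc.hyps(1)[of "S - {p}" X] by blast
  define m where "m = l(p := c)"
  have Yp0: "Y $ i $ p = (if i = p then c else 0)" for i
    unfolding col Yp by (simp add: axis_def)
  have powp: "mpow Y k $ i $ p = (if i = p then c ^ k else 0)" for k i
  proof (induction k arbitrary: i)
    case (Suc k)
    have "mpow Y (Suc k) $ i $ p = (\<Sum>a\<in>UNIV. Y $ i $ a * (if a = p then c ^ k else 0))"
      by (simp add: matrix_matrix_mult_def Suc)
    also have "\<dots> = (if i = p then c ^ Suc k else 0)" by (simp add: Yp0 if_distrib cong: if_cong)
    finally show ?case .
  qed (simp add: mat_def)
  have pow: "mpow Y k $ i $ j = mpow X k $ i $ j" if "i \<noteq> p" "j \<noteq> p" for k i j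
    using that
  proof (induction k arbitrary: i)
    case (Suc k)
    have "Y $ i $ a * mpow Y k $ a $ j = X $ i $ a * mpow X k $ a $ j" for a
      using Suc Yp0[of i] by (cases "a = p") (auto simp: X_def)
    then show ?case by (simp add: matrix_matrix_mult_def)
  qed simp
  \<comment> \<open>Positive powers only: the zeroth power has the entry 1 here.\<close>
  have powX: "mpow X (Suc k) $ p $ p = 0" for k by (simp add: X_def matrix_matrix_mult_def)
  have "trace (mpow Z (Suc k)) = (\<Sum>i\<in>S. m i ^ Suc k)" for k
  proof -
    have "trace (mpow Z (Suc k)) = trace (mpow Y (Suc k))"
      unfolding Y_def using trace_mpow_similar[OF TU UT, of Z "Suc k"] by simp
    also have "\<dots> = mpow Y (Suc k) $ p $ p + (\<Sum>i\<in>UNIV - {p}. mpow Y (Suc k) $ i $ i)"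
      unfolding trace_def by (rule sum.remove) auto
    also have "\<dots> = c ^ Suc k + (\<Sum>i\<in>UNIV - {p}. mpow X (Suc k) $ i $ i)"
      unfolding powp by (simp add: pow del: mpow.simps power.simps)
    also have "(\<Sum>i\<in>UNIV - {p}. mpow X (Suc k) $ i $ i) = trace (mpow X (Suc k))"
      unfolding trace_def by (subst sum.remove[of UNIV p]) (simp_all add: powX del: mpow.simps)
    also have "\<dots> = (\<Sum>i\<in>S - {p}. m i ^ Suc k)"
      unfolding ltr by (intro sum.cong) (auto simp: m_def)
    also have "c ^ Suc k + \<dots> = (\<Sum>i\<in>S. m i ^ Suc k)"
      using pS Suc.prems by (subst sum.remove[of S p]) (auto simp: m_def)
    finally show ?thesis .
  qed
  moreover have "\<exists>u. u \<noteq> 0 \<and> (\<forall>j. j \<notin> S \<longrightarrow> u $ j = 0) \<and> Z *v u = m i *s u" if i: "i \<in> S" for i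
  \<comment> \<open>For the eigenvalue \<open>c\<close> the vector \<open>v\<close> serves. Any
    other eigenvector \<open>u\<close> of \<open>X\<close> is first lifted to \<open>Y\<close> and
    then transported to \<open>Z\<close> by \<open>T\<close>.\<close>
  proof (cases "m i = c")
    case True
    moreover have "v \<noteq> 0" using v(1) by auto
    ultimately show ?thesis using v by auto
  next
    case False
    then have "i \<noteq> p" by (auto simp: m_def)
    then obtain u where u: "u \<noteq> 0" "\<And>j. j \<notin> S - {p} \<Longrightarrow> u $ j = 0" "X *v u = m i *s u"
      using l[of i] i by (auto simp: m_def)
    define y where "y = (Y *v u) $ p"
    \<comment> \<open>Solves \<open>y + b * c = m i * b\<close>, so the component of
      \<open>w\<close> along axis \<open>p\<close> also scales by \<open>m i\<close> under
      \<open>Y\<close>.\<close>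
    define b where "b = y / (m i - c)"
    define w where "w = u + b *s axis p 1"
    have "Y *v u = m i *s u + y *s axis p 1"
    proof -
      have "(Y *v u) $ j = (X *v u) $ j" if "j \<noteq> p" for j
        unfolding matrix_vector_mult_def using that u(2)[of p] by (auto simp: X_def intro!: sum.cong)
      then show ?thesis using u(2)[of p] by (auto simp: vec_eq_iff u(3) axis_def y_def)
    qed
    then have "Y *v w = m i *s u + (y + b * c) *s axis p 1"
      by (simp add: w_def matrix_vector_right_distrib vector_scalar_commute Yp vec.scale_left_distrib)
    moreover have "y + b * c = m i * b" using False by (simp add: b_def field_simps)
    ultimately have "Y *v w = m i *s w" by (simp add: w_def vec.scale_right_distrib)
    moreover have Zw: "Z *v (T *v w) = T *v (Y *v w)"
      unfolding Yx by (simp add: matrix_vector_mul_assoc matrix_mul_assoc TU)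
    ultimately have "Z *v (T *v w) = m i *s (T *v w)" by (simp add: vector_scalar_commute)
    moreover have "T *v w \<noteq> 0"
    proof
      assume "T *v w = 0"
      then have "w = 0" by (metis UT matrix_vector_mul_assoc matrix_vector_mul_lid matrix_vector_mult_0_right)
      moreover obtain j where "u $ j \<noteq> 0" using u(1) by (auto simp: vec_eq_iff)
      moreover have "j \<noteq> p" using u(2)[of p] calculation by auto
      moreover have "w $ j = u $ j" if "j \<noteq> p" using that by (simp add: w_def axis_def)
      ultimately show False by simp
    qed
    moreover have "(T *v w) $ j = 0" if "j \<notin> S" for j
      using that u(2)[of j] v(2)[of j] pS by (auto simp: Tx w_def axis_def)
    ultimately show ?thesis by blast
  qed
  ultimately show ?case by blast
qed

lemma trace_mpow_eigenvalues:
  fixes Z :: "complex^'n^'n"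
  shows "\<exists>l::'n \<Rightarrow> complex. (\<forall>i. \<exists>v. v \<noteq> 0 \<and> Z *v v = l i *s v) \<and> (\<forall>k. trace (mpow Z k) = (\<Sum>i\<in>UNIV. l i ^ k))"
proof -
  obtain l :: "'n \<Rightarrow> complex" where l: "\<And>i. \<exists>v. v \<noteq> 0 \<and> Z *v v = l i *s v"
    and tr: "\<And>k. trace (mpow Z (Suc k)) = (\<Sum>i\<in>UNIV. l i ^ Suc k)"
    using trace_mpow_eigenvalues_supported[of UNIV Z] by auto
  have "trace (mpow Z k) = (\<Sum>i\<in>UNIV. l i ^ k)" for k
    using tr by (cases k) (auto simp: trace_I)
  then show ?thesis using l by blast
qed

subsection \<open>A boundary second-derivative inequality\<close>

text \<open>The pole of \<open>F z / z\<close> at \<open>0\<close> can be removed without losing the sign of the imaginary part: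
  the correction \<open>c Im z / |z|\<^sup>2\<close> vanishes on the boundary of the half plane.\<close>
lemma Im_divide_nonpos_half_plane_max:
  fixes F g :: "complex \<Rightarrow> complex" and c r :: real
  assumes g: "g holomorphic_on D" and D: "open D" "{z. Im z > 0} \<subseteq> D" "ball 0 r \<subseteq> D" and r: "r > 0"
    and g_real: "\<And>x::real. \<bar>x\<bar> < r \<Longrightarrow> Im (g (of_real x)) = 0"
    and F: "\<And>z. Im z > 0 \<Longrightarrow> g z = (F z - of_real c) / z"
    and neg: "\<And>z. Im z > 0 \<Longrightarrow> Im (F z / z) \<le> 0"
    and z0: "Im z0 > 0"
  shows "Im (g z0) \<le> 0"
proof (rule field_le_epsilon)
  fix e :: real assume e: "e > 0"
  define \<rho> where "\<rho> = r / 2"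
  have \<rho>: "\<rho> > 0" "\<rho> < r" using r by (auto simp: \<rho>_def)
  have contD: "continuous_on D g" by (rule holomorphic_on_imp_continuous_on[OF g])
  have "uniformly_continuous_on (cball 0 \<rho>) g"
    by (rule compact_uniformly_continuous)
       (use \<rho> D in \<open>auto intro!: continuous_on_subset[OF contD]\<close>)
  then obtain d where d: "d > 0"
    "\<And>x y. x \<in> cball 0 \<rho> \<Longrightarrow> y \<in> cball 0 \<rho> \<Longrightarrow> dist y x < d \<Longrightarrow> dist (g y) (g x) < e"
    unfolding uniformly_continuous_on_def using e by metis
  \<comment> \<open>Height of the lower edge of the contour. The three bounds serve, in order,
    uniform continuity near \<open>0\<close>, the inclusion of \<open>z0\<close>, and the estimate
    \<open>\<bar>c\<bar> * \<eta> / \<rho>\<^sup>2 \<le> e\<close> on the lower edge away from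
    \<open>0\<close>.\<close>
  define \<eta> where "\<eta> = min (min (d / 2) (Im z0 / 2)) (e * \<rho>\<^sup>2 / (\<bar>c\<bar> + 1))"
  have \<eta>: "\<eta> > 0" "\<eta> < d" "\<eta> < Im z0" "\<eta> \<le> e * \<rho>\<^sup>2 / (\<bar>c\<bar> + 1)"
    using d e \<rho> z0 by (auto simp: \<eta>_def min_less_iff_disj intro!: divide_pos_pos add_nonneg_pos)
  have c\<eta>: "\<bar>c\<bar> * \<eta> \<le> e * \<rho>\<^sup>2"
  proof -
    have "\<bar>c\<bar> * \<eta> \<le> (\<bar>c\<bar> + 1) * \<eta>" using \<eta> by (simp add: algebra_simps)
    also have "\<dots> \<le> e * \<rho>\<^sup>2" using \<eta>(4) by (simp add: field_simps)
    finally show ?thesis .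
  qed
  \<comment> \<open>Large enough that \<open>z0\<close> is enclosed and that the correction, at most
    \<open>\<bar>c\<bar> / R\<close> on the arc, is at most \<open>e\<close>.\<close>
  define R where "R = max (norm z0 + 1) (\<bar>c\<bar> / e + 1)"
  have R: "R > norm z0" "R > 0" "\<bar>c\<bar> \<le> e * R"
  proof -
    show "R > norm z0" by (simp add: R_def)
    then show "R > 0" by (meson norm_ge_zero order_le_less_trans)
    have "\<bar>c\<bar> / e \<le> R" by (simp add: R_def)
    then show "\<bar>c\<bar> \<le> e * R" using e by (simp add: field_simps)
  qed
  define S where "S = {z. Im z > \<eta>} \<inter> ball 0 R"
  have openS: "open S" unfolding S_def by (intro open_Int open_halfspace_Im_gt open_ball)
  have closS: "closure S \<subseteq> {z. Im z \<ge> \<eta>} \<inter> cball 0 R"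
    by (rule closure_minimal) (auto simp: S_def intro!: closed_Int closed_halfspace_Im_ge)
  have Im_g: "Im (g z) \<le> \<bar>c\<bar> * Im z / (norm z)\<^sup>2" if "Im z > 0" for z
  proof -
    have "Im (g z) = Im (F z / z) + c * Im z / (norm z)\<^sup>2"
      using that by (simp add: F diff_divide_distrib Im_divide cmod_power2)
    also have "\<dots> \<le> \<bar>c\<bar> * Im z / (norm z)\<^sup>2"
    proof -
      have "c * Im z \<le> \<bar>c\<bar> * Im z" using that by (intro mult_right_mono) auto
      then have "c * Im z / (norm z)\<^sup>2 \<le> \<bar>c\<bar> * Im z / (norm z)\<^sup>2" by (intro divide_right_mono) auto
      then show ?thesis using neg[OF that] by linarith
    qed
    finally show ?thesis .
  qed
  have bound: "norm (exp (- \<i> * g z)) \<le> exp e" if "z \<in> frontier S" for z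
  proof -
    have zc: "Im z \<ge> \<eta>" "norm z \<le> R" and zn: "\<not> (Im z > \<eta> \<and> norm z < R)"
      using that closS unfolding frontier_def interior_open[OF openS] by (auto simp: S_def)
    have Imz: "Im z > 0" and nz: "norm z > 0" using zc \<eta> by auto
    \<comment> \<open>The outer arc, the lower edge away from \<open>0\<close>, and the lower edge
      near \<open>0\<close>. Only the last uses that \<open>g\<close> is real on the real
      axis.\<close>
    consider "norm z = R" | "Im z = \<eta>" "norm z \<ge> \<rho>" | "Im z = \<eta>" "norm z < \<rho>"
      using zc zn by linarith
    then have "Im (g z) \<le> e"
    proof cases
      case 1
      have "\<bar>c\<bar> * Im z \<le> e * R * R"
        using R(2,3) Imz abs_Im_le_cmod[of z] 1 by (intro mult_mono) (auto simp: e less_imp_le)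
      then have "\<bar>c\<bar> * Im z / (norm z)\<^sup>2 \<le> e"
        using 1 R(2) by (simp add: field_simps power2_eq_square)
      then show ?thesis using Im_g[OF Imz] by linarith
    next
      case 2
      have "e * \<rho>\<^sup>2 \<le> e * (norm z)\<^sup>2" using 2 \<rho> e by (intro mult_left_mono power_mono) auto
      then have "\<bar>c\<bar> * Im z \<le> e * (norm z)\<^sup>2" using c\<eta> 2 by simp
      then have "\<bar>c\<bar> * Im z / (norm z)\<^sup>2 \<le> e" using nz by (simp add: field_simps)
      then show ?thesis using Im_g[OF Imz] by linarith
    next
      case 3
      have Re: "\<bar>Re z\<bar> \<le> norm z" by (rule abs_Re_le_cmod)
      have "z - of_real (Re z) = \<i> * of_real (Im z)" by (simp add: complex_eq_iff)
      then have "dist z (of_real (Re z)) = \<eta>" using 3 \<eta> by (simp add: dist_norm norm_mult)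
      then have "dist (g z) (g (of_real (Re z))) < e"
        using 3 Re \<eta> by (intro d(2)) auto
      then have "\<bar>Im (g z - g (of_real (Re z)))\<bar> < e"
        using abs_Im_le_cmod[of "g z - g (of_real (Re z))"] by (simp add: dist_norm)
      then show ?thesis using g_real[of "Re z"] Re 3 \<rho> by simp
    qed
    then show ?thesis by (simp add: norm_exp_eq_Re)
  qed
  have subD: "closure S \<subseteq> D"
  proof -
    have "closure S \<subseteq> {z. Im z > 0}" using closS \<eta> by fastforce
    then show ?thesis using D by blast
  qed
  have "norm (exp (- \<i> * g z0)) \<le> exp e"
  \<comment> \<open>The modulus of \<open>exp (- \<i> * g z)\<close> is
    \<open>exp (Im (g z))\<close>, so a bound on the modulus bounds the imaginary part.\<close>
  proof (rule maximum_modulus_frontier[where S = S and f = "\<lambda>z. exp (- \<i> * g z)"])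
    show "(\<lambda>z. exp (- \<i> * g z)) holomorphic_on interior S"
    proof -
      have "interior S \<subseteq> D" using subD interior_subset closure_subset by blast
      then have "g holomorphic_on interior S" by (rule holomorphic_on_subset[OF g])
      then show ?thesis by (intro holomorphic_intros)
    qed
    show "continuous_on (closure S) (\<lambda>z. exp (- \<i> * g z))"
      by (intro continuous_intros continuous_on_subset[OF contD] subD)
    show "bounded S" unfolding S_def by (intro bounded_Int) auto
    show "z0 \<in> S" using \<eta> R by (auto simp: S_def)
  qed (use bound in auto)
  then show "Im (g z0) \<le> 0 + e" by (simp add: norm_exp_eq_Re)
qed

text \<open>Write \<open>F z = F 0 + z * g z\<close> with \<open>g\<close> holomorphic, so that the
  second derivative of \<open>F\<close> at \<open>0\<close> is \<open>2 * deriv g 0\<close>. As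
  \<open>g 0\<close> is real, the difference quotient of \<open>g\<close> from \<open>0\<close> to
  \<open>\<i> y\<close> has real part \<open>Im (g (\<i> y)) / y\<close>, which is nonpositive for
  \<open>y > 0\<close>.\<close>

lemma second_deriv_nonpos_of_Im_divide_nonpos:
  fixes F :: "complex \<Rightarrow> complex" and r :: real
  assumes F: "F holomorphic_on D" and D: "open D" "{z. Im z > 0} \<subseteq> D" "ball 0 r \<subseteq> D" and r: "r > 0"
    and F_real: "\<And>x::real. \<bar>x\<bar> < r \<Longrightarrow> Im (F (of_real x)) = 0"
    and neg: "\<And>z. Im z > 0 \<Longrightarrow> Im (F z / z) \<le> 0"
  shows "Re (deriv (deriv F) 0) \<le> 0"
proof -
  have 0: "0 \<in> D" using D r by auto
  define c where "c = Re (F 0)"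
  have c: "F 0 = of_real c" using F_real[of 0] r by (simp add: c_def complex_eq_iff)
  define g where "g = (\<lambda>z. if z = 0 then deriv F 0 else (F z - F 0) / (z - 0))"
  have g: "g holomorphic_on D"
    unfolding g_def by (rule pole_theorem_open_0[where g = "\<lambda>z. F z - F 0" and a = 0])
      (use F D 0 in \<open>auto intro!: holomorphic_intros simp: deriv_diff holomorphic_on_imp_differentiable_at\<close>)
  have g0: "Im (g (of_real x)) = 0" if "\<bar>x\<bar> < r" "x \<noteq> 0" for x :: real
    using that F_real[of x] by (simp add: g_def c Im_divide)
  have isCont_g: "isCont g 0"
    using holomorphic_on_imp_continuous_on[OF g] D(1) 0 continuous_on_eq_continuous_at by blast
  \<comment> \<open>The value at \<open>0\<close> is the limit of the real values taken at real
    points.\<close>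
  have Img0: "Im (g 0) = 0"
  proof -
    have "((\<lambda>x::real. Im (g (of_real x))) \<longlongrightarrow> Im (g (of_real 0))) (at 0)"
      by (intro tendsto_intros isCont_tendsto_compose[of _ g]) (use isCont_g in auto)
    moreover have "\<forall>\<^sub>F x::real in at 0. Im (g (of_real x)) = 0"
      unfolding eventually_at using r g0 by (intro exI[of _ r]) (auto simp: dist_norm)
    then have "((\<lambda>x::real. Im (g (of_real x))) \<longlongrightarrow> 0) (at 0)"
      by (rule tendsto_eventually)
    ultimately show ?thesis using tendsto_unique[of "at (0::real)"] by fastforce
  qed
  have Img: "Im (g z) \<le> 0" if "Im z > 0" for z
  proof (rule Im_divide_nonpos_half_plane_max[OF g D r _ _ neg that])
    show "Im (g (of_real x)) = 0" if "\<bar>x\<bar> < r" for x :: real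
      using g0[OF that] Img0 by (cases "x = 0") auto
    show "g z = (F z - of_real c) / z" if "Im z > 0" for z
      using that by (auto simp: g_def c)
  qed
  have dg: "(g has_field_derivative deriv g 0) (at 0)"
    using holomorphic_derivI[OF g D(1) 0] .
  have "((\<lambda>z. (g z - g 0) / (z - 0)) \<longlongrightarrow> deriv g 0) (at 0)"
    using dg unfolding has_field_derivative_iff by simp
  moreover have "filterlim (\<lambda>y::real. \<i> * of_real y) (at 0) (at_right 0)"
  proof (rule filterlim_atI)
    show "((\<lambda>y::real. \<i> * of_real y) \<longlongrightarrow> 0) (at_right 0)"
      by (auto intro!: tendsto_eq_intros)
    show "\<forall>\<^sub>F y::real in at_right 0. \<i> * of_real y \<noteq> 0"
      by (rule eventually_at_rightI[of 0 1]) auto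
  qed
  ultimately have "((\<lambda>y::real. (g (\<i> * of_real y) - g 0) / (\<i> * of_real y - 0)) \<longlongrightarrow> deriv g 0) (at_right 0)"
    by (rule filterlim_compose)
  then have "((\<lambda>y::real. Re ((g (\<i> * of_real y) - g 0) / (\<i> * of_real y - 0))) \<longlongrightarrow> Re (deriv g 0)) (at_right 0)"
    by (rule tendsto_Re)
  moreover have "\<forall>\<^sub>F y::real in at_right 0. Re ((g (\<i> * of_real y) - g 0) / (\<i> * of_real y - 0)) \<le> 0"
  proof (rule eventually_at_rightI[of 0 1])
    fix y :: real assume y: "y \<in> {0<..<1}"
    have "Im (g (\<i> * of_real y)) \<le> 0" using y by (intro Img) auto
    then show "Re ((g (\<i> * of_real y) - g 0) / (\<i> * of_real y - 0)) \<le> 0"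
      using y Img0 by (simp add: Re_divide divide_le_0_iff mult_nonpos_nonneg mult_nonneg_nonpos)
  qed auto
  ultimately have le: "Re (deriv g 0) \<le> 0"
    by (rule tendsto_upperbound) auto
  have dF: "deriv F z = g z + z * deriv g z" if "z \<in> D" for z
  proof -
    have "((\<lambda>z. F 0 + z * g z) has_field_derivative (g z + z * deriv g z)) (at z)"
      using holomorphic_derivI[OF g D(1) that] by (auto intro!: derivative_eq_intros)
    moreover have "(\<lambda>z. F 0 + z * g z) = F" by (auto simp: g_def)
    ultimately show ?thesis using DERIV_imp_deriv by metis
  qed
  have hdg: "deriv g holomorphic_on D" by (rule holomorphic_deriv[OF g D(1)])
  have "((\<lambda>z. g z + z * deriv g z) has_field_derivative (2 * deriv g 0)) (at 0)"
    using dg holomorphic_derivI[OF hdg D(1) 0] by (auto intro!: derivative_eq_intros)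
  then have "(deriv F has_field_derivative (2 * deriv g 0)) (at 0)"
    by (rule has_field_derivative_transform_within_open[OF _ D(1) 0]) (simp add: dF)
  then show ?thesis using le by (simp add: DERIV_imp_deriv)
qed

subsection \<open>The principal logarithm of a complex matrix\<close>

definition cmat :: "real^'n^'m \<Rightarrow> complex^'n^'m" where
  "cmat A = (\<chi> i j. complex_of_real (A $ i $ j))"

definition cvec :: "real^'n \<Rightarrow> complex^'n" where
  "cvec v = (\<chi> i. complex_of_real (v $ i))"

definition pencil :: "real^'n^'n \<Rightarrow> real^'n^'n \<Rightarrow> complex \<Rightarrow> complex^'n^'n" where
  "pencil P Q z = (\<chi> i j. of_real (P $ i $ j) + z * of_real (Q $ i $ j))"

definition segm :: "complex^'n^'n \<Rightarrow> real \<Rightarrow> complex^'n^'n" where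
  "segm A s = mat 1 + s *\<^sub>R (A - mat 1)"

definition clog_integrand :: "complex^'n^'n \<Rightarrow> real \<Rightarrow> complex^'n^'n" where
  "clog_integrand A s = (A - mat 1) ** matrix_inv (segm A s)"

text \<open>The principal logarithm, from
  \<open>log A = \<integral>\<^sub>0\<^sup>1 (A - I) (I + s (A - I))\<^sup>-\<^sup>1 ds\<close>.
  It is meaningful only for \<open>A\<close> without eigenvalues in \<open>(-\<infinity>, 0]\<close>,
  which is what \<open>slit_regular\<close> says.\<close>
definition clog :: "complex^'n^'n \<Rightarrow> complex^'n^'n" where
  "clog A = (\<chi> i j. integral {0..1} (\<lambda>s. clog_integrand A s $ i $ j))"

definition slit_regular :: "complex^'n^'n \<Rightarrow> bool" where
  "slit_regular A \<longleftrightarrow> (\<forall>s\<in>{0..1}. det (segm A s) \<noteq> 0)"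

section \<open>Matrix algebra and continuity of the inverse\<close>

lemma matrix_diff_ldistrib: "(A :: 'a::ring_1^'n^'m) ** (B - C) = A ** B - A ** C"
  by (simp add: vec_eq_iff matrix_matrix_mult_def right_diff_distrib sum_subtractf)

lemma matrix_diff_rdistrib: "(B - C) ** (A :: 'a::ring_1^'n^'m) = B ** A - C ** A"
  by (simp add: vec_eq_iff matrix_matrix_mult_def left_diff_distrib sum_subtractf)

lemma matrix_plus_rdistrib: "(B + C) ** (A :: 'a::semiring_1^'n^'m) = B ** A + C ** A"
  by (simp add: vec_eq_iff matrix_matrix_mult_def distrib_right sum.distrib)

lemma scaleR_matrix_vector_mult:
  "(s *\<^sub>R A) *v v = s *\<^sub>R (A *v (v :: 'a::real_algebra_1^'n))"
  by (simp add: vec_eq_iff matrix_vector_mult_def scaleR_sum_right)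

lemma mat_mult_vec: "mat k *v w = k *s (w :: 'a::semiring_1^'n)"
  by (simp add: mat_def matrix_vector_mult_def vec_eq_iff if_distrib[of "\<lambda>a. a * _"] cong: if_cong)

lemma matrix_inv_det_nz:
  fixes A :: "'a::field^'n^'n"
  assumes "det A \<noteq> 0"
  shows "A ** matrix_inv A = mat 1" "matrix_inv A ** A = mat 1"
proof -
  have "\<exists>B. A ** B = mat 1 \<and> B ** A = mat 1"
    using assms unfolding invertible_det_nz[symmetric] invertible_def .
  then have "A ** matrix_inv A = mat 1 \<and> matrix_inv A ** A = mat 1"
    unfolding matrix_inv_def by (rule someI_ex)
  then show "A ** matrix_inv A = mat 1" "matrix_inv A ** A = mat 1" by auto
qed

text \<open>Cramer's rule: entries of the inverse are quotients of determinants, which yields their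
  continuity.\<close>

lemma matrix_inv_entry:
  fixes A :: "'a::field^'n^'n"
  assumes "det A \<noteq> 0"
  shows "matrix_inv A $ k $ j = det (\<chi> i l. if l = k then axis j 1 $ i else A $ i $ l) / det A"
proof -
  have "A *v (matrix_inv A *v axis j 1) = axis j 1"
    by (simp add: matrix_vector_mul_assoc matrix_inv_det_nz[OF assms])
  then have "matrix_inv A *v axis j 1 = (\<chi> k. det (\<chi> i l. if l = k then axis j 1 $ i else A $ i $ l) / det A)"
    unfolding cramer[OF assms] .
  then have "(matrix_inv A *v axis j 1) $ k = det (\<chi> i l. if l = k then axis j 1 $ i else A $ i $ l) / det A"
    by (simp only: vec_lambda_beta)
  moreover have "(matrix_inv A *v axis j 1) $ k = matrix_inv A $ k $ j"
    by (simp add: matrix_vector_mult_def axis_def if_distrib cong: if_cong)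
  ultimately show ?thesis by simp
qed

lemma continuous_on_det:
  fixes M :: "'b::topological_space \<Rightarrow> complex^'n^'n"
  assumes "\<And>i j. continuous_on X (\<lambda>x. M x $ i $ j)"
  shows "continuous_on X (\<lambda>x. det (M x))"
  unfolding det_def by (intro continuous_intros assms)

lemma continuous_on_matrix_inv:
  fixes M :: "'b::topological_space \<Rightarrow> complex^'n^'n"
  assumes "\<And>i j. continuous_on X (\<lambda>x. M x $ i $ j)" and "\<And>x. x \<in> X \<Longrightarrow> det (M x) \<noteq> 0"
  shows "continuous_on X (\<lambda>x. matrix_inv (M x) $ i $ j)"
proof -
  have "continuous_on X (\<lambda>x. det (\<chi> k l. if l = i then axis j 1 $ k else M x $ k $ l) / det (M x))"
  proof (intro continuous_on_divide continuous_on_det)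
    show "continuous_on X (\<lambda>x. (\<chi> k l. if l = i then axis j 1 $ k else M x $ k $ l) $ a $ b)" for a b
      using assms(1) by (cases "b = i") simp_all
  qed (use assms in auto)
  then show ?thesis
    by (rule continuous_on_eq) (simp add: matrix_inv_entry assms(2))
qed

text \<open>\<open>segm A s\<close> is affine in \<open>A - mat 1\<close>, so it commutes with that
  matrix, and hence so does its inverse.\<close>

lemma clog_integrand_commute:
  assumes "slit_regular A" "s \<in> {0..1}"
  shows "clog_integrand A s = matrix_inv (segm A s) ** (A - mat 1)"
proof -
  have d: "det (segm A s) \<noteq> 0" using assms by (simp add: slit_regular_def)
  have "(A - mat 1) ** segm A s = segm A s ** (A - mat 1)"
    by (simp add: segm_def matrix_add_ldistrib matrix_plus_rdistrib matrix_scalar_ac scalar_matrix_assoc)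
  then have "matrix_inv (segm A s) ** ((A - mat 1) ** segm A s) ** matrix_inv (segm A s)
      = matrix_inv (segm A s) ** (segm A s ** (A - mat 1)) ** matrix_inv (segm A s)" by simp
  then have "matrix_inv (segm A s) ** (A - mat 1) ** (segm A s ** matrix_inv (segm A s))
      = (matrix_inv (segm A s) ** segm A s) ** (A - mat 1) ** matrix_inv (segm A s)"
    by (simp only: matrix_mul_assoc)
  then show ?thesis by (simp add: clog_integrand_def matrix_inv_det_nz[OF d])
qed

text \<open>The second resolvent identity; it exhibits the difference quotient of \<open>clog\<close>
  along a pencil.\<close>
lemma clog_integrand_diff:
  assumes A: "slit_regular A" and B: "slit_regular B" and s: "s \<in> {0..1}"
  shows "clog_integrand A s - clog_integrand B s = matrix_inv (segm B s) ** (A - B) ** matrix_inv (segm A s)"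
proof -
  have dA: "det (segm A s) \<noteq> 0" and dB: "det (segm B s) \<noteq> 0"
    using assms by (auto simp: slit_regular_def)
  \<comment> \<open>The terms with the factor \<open>s\<close> cancel on the right.\<close>
  have "A - B = segm B s ** (A - mat 1) - (B - mat 1) ** segm A s"
    by (simp add: segm_def matrix_add_ldistrib matrix_plus_rdistrib matrix_scalar_ac scalar_matrix_assoc)
  then have "matrix_inv (segm B s) ** (A - B) ** matrix_inv (segm A s)
    = (matrix_inv (segm B s) ** segm B s) ** (A - mat 1) ** matrix_inv (segm A s)
      - matrix_inv (segm B s) ** (B - mat 1) ** (segm A s ** matrix_inv (segm A s))"
    by (simp only: matrix_diff_ldistrib matrix_diff_rdistrib matrix_mul_assoc)
  then show ?thesis
    unfolding clog_integrand_commute[OF B s]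
    by (simp add: clog_integrand_def matrix_inv_det_nz[OF dA] matrix_inv_det_nz[OF dB])
qed

lemma continuous_on_clog_integrand:
  assumes "slit_regular A"
  shows "continuous_on {0..1} (\<lambda>s. clog_integrand A s $ i $ j)"
proof -
  have "continuous_on {0..1} (\<lambda>s. matrix_inv (segm A s) $ i $ j)" for i j
    by (rule continuous_on_matrix_inv)
       (use assms in \<open>auto simp: slit_regular_def segm_def intro!: continuous_intros\<close>)
  then show ?thesis
    unfolding clog_integrand_def matrix_matrix_mult_def
    by (simp del: vector_minus_component) (intro continuous_on_sum continuous_on_mult continuous_on_const)
qed

lemma has_integral_clog:
  assumes "slit_regular A"
  shows "((\<lambda>s. clog_integrand A s $ i $ j) has_integral clog A $ i $ j) {0..1}"
  unfolding clog_def using continuous_on_clog_integrand[OF assms, of i j]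
  by (simp add: integrable_continuous_interval integrable_integral)

lemma has_integral_clog_vec:
  assumes "slit_regular A"
  shows "((\<lambda>s. (clog_integrand A s *v w) $ i) has_integral (clog A *v w) $ i) {0..1}"
  unfolding matrix_vector_mult_def using has_integral_clog[OF assms]
  by (auto intro!: has_integral_sum has_integral_mult_left)

text \<open>On the eigenvector the integrand acts as the scalar
  \<open>(c - 1) / (1 + s * (c - 1))\<close>, with antiderivative
  \<open>ln (1 + s * (c - 1))\<close>.\<close>

lemma clog_eigenvector:
  assumes A: "slit_regular A" and v: "A *v v = of_real c *s v" and c: "c > 0"
  shows "clog A *v v = of_real (ln c) *s v"
proof (subst vec_eq_iff, intro allI)
  fix i
  have pos: "1 + s * (c - 1) > 0" if "s \<in> {0..1}" for s
  proof -
    have "1 + s * (c - 1) = (1 - s) + s * c" by (simp add: algebra_simps)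
    moreover have "\<dots> > 0" using that c by (cases "s = 0") (auto intro: add_nonneg_pos)
    ultimately show ?thesis by simp
  qed
  have val: "clog_integrand A s *v v = of_real ((c - 1) / (1 + s * (c - 1))) *s v" if s: "s \<in> {0..1}" for s
  proof -
    have d: "det (segm A s) \<noteq> 0" using A s by (simp add: slit_regular_def)
    have A1: "(A - mat 1) *v v = of_real (c - 1) *s v"
      using v by (simp add: matrix_vector_mult_diff_rdistrib vec_eq_iff algebra_simps)
    have "segm A s *v v = v + s *\<^sub>R ((A - mat 1) *v v)"
      by (simp add: segm_def matrix_vector_mult_add_rdistrib scaleR_matrix_vector_mult)
    also have "\<dots> = of_real (1 + s * (c - 1)) *s v"
      unfolding A1 by (simp add: vec_eq_iff) (simp add: scaleR_conv_of_real algebra_simps)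
    finally have "v = matrix_inv (segm A s) *v (of_real (1 + s * (c - 1)) *s v)"
      by (metis matrix_inv_det_nz(2)[OF d] matrix_vector_mul_assoc matrix_vector_mul_lid)
    then have e: "v = of_real (1 + s * (c - 1)) *s (matrix_inv (segm A s) *v v)"
      by (simp only: vector_scalar_commute)
    have "of_real (1 / (1 + s * (c - 1))) *s v = matrix_inv (segm A s) *v v"
    proof -
      have "of_real (1 / (1 + s * (c - 1))) *s v
        = of_real (1 / (1 + s * (c - 1))) *s (of_real (1 + s * (c - 1)) *s (matrix_inv (segm A s) *v v))"
        using e by simp
      also have "\<dots> = matrix_inv (segm A s) *v v"
        using pos[OF s] by (simp only: vec.scale_scale of_real_mult[symmetric]) simp
      finally show ?thesis .
    qed
    then have "clog_integrand A s *v v = (A - mat 1) *v (of_real (1 / (1 + s * (c - 1))) *s v)"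
      by (simp add: clog_integrand_def flip: matrix_vector_mul_assoc)
    also have "\<dots> = of_real (1 / (1 + s * (c - 1))) *s (of_real (c - 1) *s v)"
      by (simp only: vector_scalar_commute A1)
    also have "\<dots> = of_real ((c - 1) / (1 + s * (c - 1))) *s v"
      by (simp only: vec.scale_scale of_real_mult[symmetric]) simp
    finally show ?thesis .
  qed
  have "((\<lambda>s. (c - 1) / (1 + s * (c - 1))) has_integral (ln (1 + 1 * (c - 1)) - ln (1 + 0 * (c - 1)))) {0..1}"
  proof (rule fundamental_theorem_of_calculus)
    fix s :: real assume s: "s \<in> {0..1}"
    show "((\<lambda>s. ln (1 + s * (c - 1))) has_vector_derivative (c - 1) / (1 + s * (c - 1))) (at s within {0..1})"
      using pos[OF s] unfolding has_real_derivative_iff_has_vector_derivative[symmetric]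
      by (auto intro!: derivative_eq_intros)
  qed simp
  then have "((\<lambda>s. (c - 1) / (1 + s * (c - 1))) has_integral ln c) {0..1}" by simp
  from has_integral_linear[OF this bounded_linear_of_real[where 'a = complex]]
  have "((\<lambda>s. complex_of_real ((c - 1) / (1 + s * (c - 1)))) has_integral complex_of_real (ln c)) {0..1}"
    by (simp add: o_def)
  from has_integral_mult_left[OF this, of "v $ i"]
  have "((\<lambda>s. (clog_integrand A s *v v) $ i) has_integral of_real (ln c) * v $ i) {0..1}"
    by (rule has_integral_eq[rotated]) (simp add: val)
  from has_integral_unique[OF has_integral_clog_vec[OF A, of v i] this]
  show "(clog A *v v) $ i = (of_real (ln c) *s v) $ i" by simp
qed

subsection \<open>Logarithms of matrix pencils\<close>

definition hip :: "complex^'n \<Rightarrow> complex^'n \<Rightarrow> complex" where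
  "hip u v = (\<Sum>i\<in>UNIV. u $ i * cnj (v $ i))"

text \<open>The Hermitian form of a real symmetric matrix at a complex vector, split into real and
  imaginary parts so that real definiteness applies to each.\<close>

definition qform :: "real^'n^'n \<Rightarrow> complex^'n \<Rightarrow> real" where
  "qform P u = (\<chi> i. Re (u $ i)) \<bullet> (P *v (\<chi> i. Re (u $ i))) + (\<chi> i. Im (u $ i)) \<bullet> (P *v (\<chi> i. Im (u $ i)))"

lemma hip_add_left: "hip (u + u') v = hip u v + hip u' v"
  by (simp add: hip_def distrib_right sum.distrib)

lemma hip_diff_left: "hip (u - u') v = hip u v - hip u' v"
  by (simp add: hip_def left_diff_distrib sum_subtractf)

lemma hip_smult_left: "hip (c *s u) v = c * hip u v"
  by (simp add: hip_def sum_distrib_left mult.assoc)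

lemma hip_add_right: "hip u (v + v') = hip u v + hip u v'"
  by (simp add: hip_def distrib_left sum.distrib)

lemma hip_scaleR_right: "hip u (s *\<^sub>R v) = of_real s * hip u v"
  by (simp add: hip_def sum_distrib_left) (simp add: scaleR_conv_of_real mult_ac)

lemma hip_self: "hip u u = of_real (\<Sum>i\<in>UNIV. (cmod (u $ i))\<^sup>2)"
  unfolding hip_def of_real_sum complex_norm_square ..

lemma hip_self_pos: "u \<noteq> 0 \<Longrightarrow> (\<Sum>i\<in>UNIV. (cmod (u $ i))\<^sup>2) > 0"
proof -
  assume "u \<noteq> 0"
  then obtain i where "u $ i \<noteq> 0" by (auto simp: vec_eq_iff)
  then show ?thesis by (intro sum_pos2[of _ i]) auto
qed

lemma symmetric_mat_entry: "symmetric_mat P \<Longrightarrow> P $ i $ j = P $ j $ i"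
  unfolding symmetric_mat_def transpose_def by (metis vec_lambda_beta)

text \<open>The products of real with imaginary parts cancel by the symmetry of
  \<open>P\<close>.\<close>

lemma hip_cmat:
  assumes "symmetric_mat P"
  shows "hip (cmat P *v u) u = of_real (qform P u)"
proof (rule complex_eqI)
  show "Re (hip (cmat P *v u) u) = Re (of_real (qform P u))"
    by (simp add: hip_def qform_def cmat_def matrix_vector_mult_def inner_vec_def sum_distrib_left
        sum_distrib_right sum.distrib[symmetric] algebra_simps)
  define t where "t = (\<Sum>i\<in>UNIV. \<Sum>j\<in>UNIV. P $ i $ j * (Im (u $ j) * Re (u $ i)))"
  have "t = (\<Sum>j\<in>UNIV. \<Sum>i\<in>UNIV. P $ i $ j * (Im (u $ j) * Re (u $ i)))"
    unfolding t_def by (rule sum.swap)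
  also have "\<dots> = (\<Sum>i\<in>UNIV. \<Sum>j\<in>UNIV. P $ i $ j * (Re (u $ j) * Im (u $ i)))"
    by (intro sum.cong refl) (simp add: symmetric_mat_entry[OF assms] mult_ac)
  finally have t: "t = (\<Sum>i\<in>UNIV. \<Sum>j\<in>UNIV. P $ i $ j * (Re (u $ j) * Im (u $ i)))" .
  have "Im (hip (cmat P *v u) u) = t - (\<Sum>i\<in>UNIV. \<Sum>j\<in>UNIV. P $ i $ j * (Re (u $ j) * Im (u $ i)))"
    unfolding t_def
    by (simp add: hip_def cmat_def matrix_vector_mult_def sum_distrib_left
        sum_distrib_right sum_subtractf[symmetric] algebra_simps)
  then show "Im (hip (cmat P *v u) u) = Im (of_real (qform P u))" using t by simp
qed

lemma pencil_mult_vec: "pencil P Q z *v u = cmat P *v u + z *s (cmat Q *v u)"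
  by (simp add: vec_eq_iff pencil_def cmat_def matrix_vector_mult_def distrib_right sum.distrib
      sum_distrib_left mult.assoc)

lemma hip_pencil:
  assumes "symmetric_mat P" "symmetric_mat Q"
  shows "hip (pencil P Q z *v u) u = of_real (qform P u) + z * of_real (qform Q u)"
  by (simp add: pencil_mult_vec hip_add_left hip_smult_left hip_cmat assms)

lemma qform_pencil: "qform (P + x *\<^sub>R Q) u = qform P u + x * qform Q u"
  by (simp add: qform_def matrix_vector_mult_add_rdistrib scaleR_matrix_vector_mult inner_add_right algebra_simps)

lemma qform_nonneg: "pos_semidef_mat Q \<Longrightarrow> qform Q u \<ge> 0"
  by (simp add: qform_def pos_semidef_mat_def)

lemma qform_pos:
  assumes "pos_def_mat P" "u \<noteq> 0"
  shows "qform P u > 0"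
proof -
  have "(\<chi> i. Re (u $ i)) \<noteq> 0 \<or> (\<chi> i. Im (u $ i)) \<noteq> 0"
    using assms(2) by (auto simp: vec_eq_iff complex_eq_iff)
  moreover have "x \<bullet> (P *v x) \<ge> 0" for x
    using assms(1) by (cases "x = 0") (auto simp: pos_def_mat_def less_imp_le)
  ultimately show ?thesis using assms(1) unfolding pos_def_mat_def qform_def
    by (metis add_nonneg_pos add_pos_nonneg)
qed

section \<open>Slit planes and admissible pencils\<close>

abbreviation slit :: "real \<Rightarrow> complex set" where
  "slit a \<equiv> - (complex_of_real ` {..a})"

lemma mem_slit_iff: "z \<in> slit a \<longleftrightarrow> Im z \<noteq> 0 \<or> Re z > a"
  by (auto simp: complex_eq_iff image_iff)

lemma open_slit: "open (slit a)"
  by (metis closed_slot_left open_Compl)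

text \<open>Conditions under which \<open>P + z Q\<close> has a principal logarithm for every
  \<open>z\<close> in \<open>slit a\<close>.\<close>

definition admissible_pencil :: "real^'n^'n \<Rightarrow> real^'n^'n \<Rightarrow> real \<Rightarrow> bool" where
  "admissible_pencil P Q a \<longleftrightarrow> symmetric_mat P \<and> pos_semidef_mat Q \<and> (\<forall>x>a. pos_def_mat (P + x *\<^sub>R Q))"

lemma segm_mult_vec: "segm A s *v u = u + s *\<^sub>R (A *v u - u)"
  by (simp add: segm_def matrix_vector_mult_add_rdistrib scaleR_matrix_vector_mult matrix_vector_mult_diff_rdistrib)

text \<open>Pair the equation for a null vector \<open>u\<close> of the segment with
  \<open>u\<close>. Its imaginary part forces \<open>s = 0\<close>, \<open>Im z = 0\<close> or
  \<open>qform Q u = 0\<close>, and in each case the real part is a positive number.\<close>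

lemma slit_regular_pencil:
  assumes adm: "admissible_pencil P Q a" and z: "z \<in> slit a"
  shows "slit_regular (pencil P Q z)"
  unfolding slit_regular_def
proof (intro ballI notI)
  fix s :: real assume s: "s \<in> {0..1}" and "det (segm (pencil P Q z) s) = 0"
  then have "\<not> invertible (segm (pencil P Q z) s)" by (simp add: invertible_det_nz)
  then obtain u where u: "u \<noteq> 0" "segm (pencil P Q z) s *v u = 0"
    unfolding invertible_left_inverse matrix_left_invertible_ker by blast
  have sym: "symmetric_mat P" "symmetric_mat Q"
    using adm by (auto simp: admissible_pencil_def pos_semidef_mat_def)
  define n where "n = (\<Sum>i\<in>UNIV. (cmod (u $ i))\<^sup>2)"
  have n: "n > 0" unfolding n_def by (rule hip_self_pos[OF u(1)])
  have "0 = hip (u + s *\<^sub>R (pencil P Q z *v u - u)) u"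
    using u(2) by (simp add: segm_mult_vec hip_def)
  also have "u + s *\<^sub>R (pencil P Q z *v u - u) = u + of_real s *s (pencil P Q z *v u - u)"
    by (simp add: vec_eq_iff) (simp add: scaleR_conv_of_real right_diff_distrib)
  also have "hip \<dots> u = of_real n + of_real s * (of_real (qform P u) + z * of_real (qform Q u) - of_real n)"
    using hip_self[of u, folded n_def]
    by (simp add: hip_add_left hip_smult_left hip_diff_left hip_pencil[OF sym] right_diff_distrib)
  finally have eq: "0 = of_real n + of_real s * (of_real (qform P u) + z * of_real (qform Q u) - of_real n)" .
  from arg_cong[OF eq, of Im] have im: "s * (Im z * qform Q u) = 0" by simp
  from arg_cong[OF eq, of Re] have re: "(1 - s) * n + s * (qform P u + Re z * qform Q u) = 0"
    by (simp add: algebra_simps)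
  have pos: "qform P u + Re z * qform Q u > 0" if "s \<noteq> 0"
  proof (cases "Im z = 0")
    case True
    then have "Re z > a" using z by (simp only: mem_slit_iff simp_thms)
    then have "pos_def_mat (P + Re z *\<^sub>R Q)" using adm by (auto simp: admissible_pencil_def)
    from qform_pos[OF this u(1)] show ?thesis by (simp add: qform_pencil)
  next
    case False
    then have q: "qform Q u = 0" using im that by simp
    \<comment> \<open>Any real point beyond \<open>a\<close> would do, since the form of
      \<open>Q\<close> vanishes at \<open>u\<close>.\<close>
    have "pos_def_mat (P + (a + 1) *\<^sub>R Q)" using adm by (auto simp: admissible_pencil_def)
    from qform_pos[OF this u(1)] show ?thesis using q by (simp add: qform_pencil)
  qed
  show False
  proof (cases "s = 0")
    case True
    then show False using re n by simp
  next
    case False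
    then have "s * (qform P u + Re z * qform Q u) > 0" using s pos by simp
    moreover have "(1 - s) * n \<ge> 0" using s n by simp
    ultimately show False using re by linarith
  qed
qed

lemma has_integral_hip_clog:
  assumes "slit_regular A"
  shows "((\<lambda>s. hip (clog_integrand A s *v w) w) has_integral hip (clog A *v w) w) {0..1}"
  unfolding hip_def using has_integral_clog_vec[OF assms]
  by (auto intro!: has_integral_sum has_integral_mult_left)

text \<open>With \<open>w = u + s (A u - u)\<close> the integrand pairs \<open>A u - u\<close> with \<open>w\<close>, and the part
  of \<open>w\<close> parallel to \<open>A u - u\<close> contributes a real number.\<close>
lemma Im_hip_clog_integrand:
  assumes A: "slit_regular A" and s: "s \<in> {0..1}"
  shows "\<exists>u. Im (hip (clog_integrand A s *v w) w) = Im (hip (A *v u) u)"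
proof -
  have d: "det (segm A s) \<noteq> 0" using A s by (simp add: slit_regular_def)
  define u where "u = matrix_inv (segm A s) *v w"
  have "segm A s *v u = w" by (simp add: u_def matrix_vector_mul_assoc matrix_inv_det_nz[OF d])
  then have w: "w = u + s *\<^sub>R (A *v u - u)" by (simp add: segm_mult_vec)
  have "clog_integrand A s *v w = A *v u - u"
    by (simp add: clog_integrand_def u_def matrix_vector_mult_diff_rdistrib flip: matrix_vector_mul_assoc)
  then have "hip (clog_integrand A s *v w) w = hip (A *v u - u) u + of_real s * hip (A *v u - u) (A *v u - u)"
    by (subst w) (simp add: hip_add_right hip_scaleR_right)
  then have "Im (hip (clog_integrand A s *v w) w) = Im (hip (A *v u) u)"
    by (simp add: hip_diff_left hip_self)
  then show ?thesis by blast
qed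

text \<open>For each \<open>s\<close> the integrand has imaginary part
  \<open>Im z * qform Q u\<close> for some \<open>u\<close>. Dividing by \<open>Im z\<close> treats
  both half planes at once.\<close>

lemma Im_hip_clog_pencil:
  assumes adm: "admissible_pencil P Q a" and z: "Im z \<noteq> 0"
  shows "Im (hip (clog (pencil P Q z) *v w) w) / Im z \<ge> 0"
proof -
  have reg: "slit_regular (pencil P Q z)"
    by (rule slit_regular_pencil[OF adm]) (use z in \<open>simp only: mem_slit_iff simp_thms\<close>)
  have sym: "symmetric_mat P" "symmetric_mat Q" and psd: "pos_semidef_mat Q"
    using adm by (auto simp: admissible_pencil_def pos_semidef_mat_def)
  let ?f = "\<lambda>s. Im (hip (clog_integrand (pencil P Q z) s *v w) w)"
  have "(?f has_integral Im (hip (clog (pencil P Q z) *v w) w)) {0..1}"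
    using has_integral_linear[OF has_integral_hip_clog[OF reg, of w] bounded_linear_Im] by (simp add: o_def)
  from has_integral_divide[OF this, of "Im z"]
  show ?thesis
  proof (rule has_integral_nonneg)
    fix s :: real assume s: "s \<in> {0..1}"
    obtain u where "?f s = Im (hip (pencil P Q z *v u) u)"
      using Im_hip_clog_integrand[OF reg s] by blast
    then have "?f s = Im z * qform Q u" by (simp add: hip_pencil[OF sym])
    then show "?f s / Im z \<ge> 0" using z qform_nonneg[OF psd, of u] by simp
  qed
qed

corollary Im_hip_clog_pencil_nonneg:
  assumes "admissible_pencil P Q a" "Im z > 0"
  shows "Im (hip (clog (pencil P Q z) *v w) w) \<ge> 0"
  using Im_hip_clog_pencil[OF assms(1), of z w] assms(2) by (simp add: zero_le_divide_iff)

corollary Im_hip_clog_pencil_nonpos: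
  assumes "admissible_pencil P Q a" "Im z < 0"
  shows "Im (hip (clog (pencil P Q z) *v w) w) \<le> 0"
  using Im_hip_clog_pencil[OF assms(1), of z w] assms(2) by (simp add: zero_le_divide_iff)

text \<open>By the resolvent identity the difference quotient at \<open>z0\<close> is the integral
  over \<open>s\<close> of \<open>g z s\<close>. This depends continuously on \<open>z\<close>, also
  at \<open>z0\<close>, so the quotient converges.\<close>

lemma clog_pencil_holomorphic:
  assumes adm: "admissible_pencil P Q a"
  shows "(\<lambda>z. clog (pencil P Q z) $ i $ j) holomorphic_on slit a"
  unfolding holomorphic_on_open[OF open_slit]
proof (intro ballI)
  fix z0 assume z0: "z0 \<in> slit a"
  note reg = slit_regular_pencil[OF adm]
  define inv where "inv z s = matrix_inv (segm (pencil P Q z) s)" for z s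
  define g where "g z s = (inv z0 s ** cmat Q ** inv z s) $ i $ j" for z s
  have inv_cont: "continuous_on (slit a \<times> cbox 0 1) (\<lambda>p. inv (fst p) (snd p) $ i $ j)" for i j
    unfolding inv_def
    by (rule continuous_on_matrix_inv)
       (use reg in \<open>auto simp: slit_regular_def segm_def pencil_def intro!: continuous_intros\<close>)
  have inv0_cont: "continuous_on (slit a \<times> cbox 0 1) (\<lambda>p. inv z0 (snd p) $ i $ j)" for i j
    unfolding inv_def
    by (rule continuous_on_matrix_inv)
       (use reg[OF z0] in \<open>auto simp: slit_regular_def segm_def pencil_def intro!: continuous_intros\<close>)
  have "continuous_on (slit a \<times> cbox 0 1) (\<lambda>p. g (fst p) (snd p))"
    unfolding g_def matrix_matrix_mult_def vec_lambda_beta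
    by (intro continuous_on_sum continuous_on_mult continuous_on_const inv_cont inv0_cont)
  then have g_cont: "continuous_on (slit a \<times> cbox 0 1) (\<lambda>(z, s). g z s)" by (simp add: split_def)
  have G_cont: "continuous_on (slit a) (\<lambda>z. integral (cbox 0 1) (g z))"
    by (rule integral_continuous_on_param[OF g_cont])
  have diff: "(clog (pencil P Q z) $ i $ j - clog (pencil P Q z0) $ i $ j) / (z - z0) = integral (cbox 0 1) (g z)"
    if z: "z \<in> slit a" "z \<noteq> z0" for z
  proof -
    have "((\<lambda>s. clog_integrand (pencil P Q z) s $ i $ j - clog_integrand (pencil P Q z0) s $ i $ j)
       has_integral (clog (pencil P Q z) $ i $ j - clog (pencil P Q z0) $ i $ j)) {0..1}"
      by (intro has_integral_diff has_integral_clog reg z z0)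
    then have "((\<lambda>s. (z - z0) * g z s) has_integral (clog (pencil P Q z) $ i $ j - clog (pencil P Q z0) $ i $ j)) {0..1}"
    proof (rule has_integral_eq[rotated])
      fix s :: real assume s: "s \<in> {0..1}"
      have "pencil P Q z - pencil P Q z0 = (\<chi> i j. (z - z0) * cmat Q $ i $ j)"
        by (simp add: vec_eq_iff pencil_def cmat_def algebra_simps)
      then have "clog_integrand (pencil P Q z) s - clog_integrand (pencil P Q z0) s
         = inv z0 s ** (\<chi> i j. (z - z0) * cmat Q $ i $ j) ** inv z s"
        using clog_integrand_diff[OF reg[OF z(1)] reg[OF z0] s] by (simp add: inv_def)
      then have "(clog_integrand (pencil P Q z) s - clog_integrand (pencil P Q z0) s) $ i $ j
        = (z - z0) * g z s"
        by (simp add: g_def matrix_matrix_mult_def sum_distrib_left sum_distrib_right mult_ac)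
      then show "clog_integrand (pencil P Q z) s $ i $ j - clog_integrand (pencil P Q z0) s $ i $ j = (z - z0) * g z s"
        by simp
    qed
    from has_integral_divide[OF this, of "z - z0"]
    have "(g z has_integral ((clog (pencil P Q z) $ i $ j - clog (pencil P Q z0) $ i $ j) / (z - z0))) {0..1}"
      using z by simp
    then show ?thesis by (simp add: integral_unique)
  qed
  have "((\<lambda>z. integral (cbox 0 1) (g z)) \<longlongrightarrow> integral (cbox 0 1) (g z0)) (at z0)"
    using G_cont open_slit z0 by (metis continuous_on_def at_within_open)
  then have "((\<lambda>z. (clog (pencil P Q z) $ i $ j - clog (pencil P Q z0) $ i $ j) / (z - z0))
      \<longlongrightarrow> integral (cbox 0 1) (g z0)) (at z0)"
    by (rule Lim_transform_within_open[OF _ open_slit z0]) (simp add: diff)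
  then show "\<exists>f'. ((\<lambda>z. clog (pencil P Q z) $ i $ j) has_field_derivative f') (at z0)"
    unfolding has_field_derivative_iff by blast
qed

subsection \<open>Exponential and logarithm of real symmetric matrices\<close>

lemma mat_pow_eq_mpow: "mat_pow A k = mpow A k"
  by (induction k) simp_all

text \<open>Entrywise domination of the exponential series by a scalar one.\<close>

lemma norm_mpow_entry_le:
  fixes Z :: "'a::{real_normed_algebra_1}^'n^'n"
  assumes "\<And>i j. norm (Z $ i $ j) \<le> M"
  shows "norm (mpow Z k $ i $ j) \<le> (real CARD('n) * M) ^ k"
proof -
  have M: "M \<ge> 0" using assms norm_ge_zero order_trans by blast
  show ?thesis
  proof (induction k arbitrary: i)
    case 0
    show ?case by (simp add: mat_def)
  next
    case (Suc k)
    have "norm (mpow Z (Suc k) $ i $ j) \<le> (\<Sum>a\<in>UNIV. norm (Z $ i $ a * mpow Z k $ a $ j))"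
      by (simp add: matrix_matrix_mult_def norm_sum)
    also have "\<dots> \<le> (\<Sum>a\<in>(UNIV::'n set). M * (real CARD('n) * M) ^ k)"
    proof (rule sum_mono)
      fix a
      have "norm (Z $ i $ a * mpow Z k $ a $ j) \<le> norm (Z $ i $ a) * norm (mpow Z k $ a $ j)"
        by (rule norm_mult_ineq)
      also have "\<dots> \<le> M * (real CARD('n) * M) ^ k"
        using M by (intro mult_mono assms Suc) auto
      finally show "norm (Z $ i $ a * mpow Z k $ a $ j) \<le> M * (real CARD('n) * M) ^ k" .
    qed
    also have "\<dots> = (real CARD('n) * M) ^ Suc k" by simp
    finally show ?case .
  qed
qed

lemma finite_matrix_bound: "\<exists>M. \<forall>i j. norm ((Z :: 'a::real_normed_vector^'n^'m) $ i $ j) \<le> M"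
proof -
  have "norm (Z $ i $ j) \<le> (\<Sum>i\<in>UNIV. \<Sum>j\<in>UNIV. norm (Z $ i $ j))" for i j
  proof -
    have "norm (Z $ i $ j) \<le> (\<Sum>j\<in>UNIV. norm (Z $ i $ j))" by (rule member_le_sum) auto
    also have "\<dots> \<le> (\<Sum>i\<in>UNIV. \<Sum>j\<in>UNIV. norm (Z $ i $ j))"
      by (rule member_le_sum[where f = "\<lambda>i. \<Sum>j\<in>UNIV. norm (Z $ i $ j)"]) (auto intro: sum_nonneg)
    finally show ?thesis .
  qed
  then show ?thesis by blast
qed

lemma mat_exp_sums: "(\<lambda>k. (1 / fact k) *\<^sub>R mat_pow A k) sums mat_exp A"
proof -
  obtain M where M: "\<And>i j. norm (A $ i $ j) \<le> M" using finite_matrix_bound[of A] by blast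
  have summ: "summable (\<lambda>k. 1 / fact k * mat_pow A k $ i $ j)" for i j
  proof (rule summable_comparison_test')
    show "summable (\<lambda>k. inverse (fact k) * (real CARD('a) * M) ^ k)" by (rule summable_exp)
    show "norm (1 / fact k * mat_pow A k $ i $ j) \<le> inverse (fact k) * (real CARD('a) * M) ^ k" for k
      using norm_mpow_entry_le[of A M k i j] M
      by (simp add: mat_pow_eq_mpow abs_mult divide_inverse mult_left_mono)
  qed
  have "(\<lambda>k. (1 / fact k) *\<^sub>R mat_pow A k) sums (\<chi> i j. \<Sum>k. 1 / fact k * mat_pow A k $ i $ j)"
    unfolding sums_def
    by (intro vec_tendstoI) (use summable_LIMSEQ[OF summ] in simp)
  then have "summable (\<lambda>k. (1 / fact k) *\<^sub>R mat_pow A k)" by (rule sums_summable)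
  then show ?thesis unfolding mat_exp_def by (rule summable_sums)
qed

lemma mat_exp_sums_entry: "(\<lambda>k. 1 / fact k * mat_pow A k $ i $ j) sums (mat_exp A $ i $ j)"
proof -
  have "(\<lambda>k. ((1 / fact k) *\<^sub>R mat_pow A k) $ i $ j) sums (mat_exp A $ i $ j)"
    by (intro bounded_linear.sums[OF bounded_linear_vec_nth] mat_exp_sums)
  then show ?thesis by simp
qed

lemma mat_exp_eigenvector:
  assumes v: "A *v v = d *\<^sub>R v"
  shows "mat_exp A *v v = exp d *\<^sub>R v"
proof (subst vec_eq_iff, intro allI)
  fix i
  have pw: "mat_pow A k *v v = d ^ k *\<^sub>R v" for k
    by (induction k) (simp_all add: v matrix_vector_mult_scaleR flip: matrix_vector_mul_assoc)
  have "(\<lambda>k. \<Sum>j\<in>UNIV. (1 / fact k * mat_pow A k $ i $ j) * v $ j) sums (\<Sum>j\<in>UNIV. mat_exp A $ i $ j * v $ j)"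
    by (intro sums_sum sums_mult2 mat_exp_sums_entry)
  moreover have "(\<Sum>j\<in>UNIV. (1 / fact k * mat_pow A k $ i $ j) * v $ j) = (d ^ k /\<^sub>R fact k) * v $ i" for k
  proof -
    have "(\<Sum>j\<in>UNIV. (1 / fact k * mat_pow A k $ i $ j) * v $ j) = 1 / fact k * (mat_pow A k *v v) $ i"
      by (simp add: matrix_vector_mult_def sum_distrib_left mult.assoc)
    then show ?thesis by (simp add: pw divide_inverse)
  qed
  moreover have "(\<lambda>k. (d ^ k /\<^sub>R fact k) * v $ i) sums (exp d * v $ i)"
    by (intro sums_mult2 exp_converges)
  ultimately have "(\<Sum>j\<in>UNIV. mat_exp A $ i $ j * v $ j) = exp d * v $ i"
    using sums_unique2 by fastforce
  then show "(mat_exp A *v v) $ i = (exp d *\<^sub>R v) $ i" by (simp add: matrix_vector_mult_def)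
qed

section \<open>The trace of the exponential of a complex matrix\<close>

text \<open>Stands for \<open>tr exp Z\<close>, with the trace taken term by term, so that only
  scalar series occur.\<close>

definition texp :: "complex^'n^'n \<Rightarrow> complex" where
  "texp Z = (\<Sum>k. trace (mpow Z k) / fact k)"

lemma cmat_mpow: "cmat (mpow A k) = mpow (cmat A) k"
proof (induction k)
  case 0
  show ?case by (simp add: cmat_def mat_def vec_eq_iff)
next
  case (Suc k)
  then show ?case by (simp add: cmat_def matrix_matrix_mult_def vec_eq_iff)
qed

lemma texp_cmat: "texp (cmat A) = of_real (trace (mat_exp A))"
proof -
  have "(\<lambda>k. \<Sum>i\<in>UNIV. 1 / fact k * mat_pow A k $ i $ i) sums trace (mat_exp A)"
    unfolding trace_def by (intro sums_sum mat_exp_sums_entry)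
  then have "(\<lambda>k. complex_of_real (\<Sum>i\<in>UNIV. 1 / fact k * mat_pow A k $ i $ i)) sums of_real (trace (mat_exp A))"
    by (rule sums_of_real)
  moreover have "complex_of_real (\<Sum>i\<in>UNIV. 1 / fact k * mat_pow A k $ i $ i) = trace (mpow (cmat A) k) / fact k" for k
    unfolding cmat_mpow[symmetric] by (simp add: trace_def cmat_def mat_pow_eq_mpow sum_divide_distrib)
  ultimately show ?thesis unfolding texp_def by (simp add: sums_iff)
qed

lemma texp_eq_sum_exp_eigenvalues:
  fixes Z :: "complex^'n^'n"
  shows "\<exists>l::'n \<Rightarrow> complex. (\<forall>i. \<exists>v. v \<noteq> 0 \<and> Z *v v = l i *s v) \<and> texp Z = (\<Sum>i\<in>UNIV. exp (l i))"
proof -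
  obtain l :: "'n \<Rightarrow> complex" where l: "\<And>i. \<exists>v. v \<noteq> 0 \<and> Z *v v = l i *s v"
    and tr: "\<And>k. trace (mpow Z k) = (\<Sum>i\<in>UNIV. l i ^ k)"
    using trace_mpow_eigenvalues[of Z] by blast
  have "(\<lambda>k. \<Sum>i\<in>UNIV. l i ^ k /\<^sub>R fact k) sums (\<Sum>i\<in>UNIV. exp (l i))"
    by (intro sums_sum exp_converges)
  moreover have "(\<Sum>i\<in>UNIV. l i ^ k /\<^sub>R fact k) = trace (mpow Z k) / fact k" for k
    by (simp add: tr sum_divide_distrib scaleR_conv_of_real divide_inverse mult.commute sum_distrib_left)
  ultimately have "texp Z = (\<Sum>i\<in>UNIV. exp (l i))" unfolding texp_def by (simp add: sums_iff)
  then show ?thesis using l by blast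
qed

text \<open>The partial sums are polynomials in the entries and converge uniformly on closed discs
  by the Weierstrass test.\<close>

lemma holomorphic_texp:
  fixes Z :: "complex \<Rightarrow> complex^'n^'n"
  assumes Z: "\<And>i j. (\<lambda>z. Z z $ i $ j) holomorphic_on D" and D: "open D"
  shows "(\<lambda>z. texp (Z z)) holomorphic_on D"
proof (rule holomorphic_uniform_sequence[OF D])
  have pw: "(\<lambda>z. mpow (Z z) k $ i $ j) holomorphic_on D" for k i j
  proof (induction k arbitrary: i)
    case 0
    show ?case by simp
  next
    case (Suc k)
    then show ?case by (auto simp: matrix_matrix_mult_def intro!: holomorphic_intros Z)
  qed
  show "(\<lambda>z. \<Sum>k<n. trace (mpow (Z z) k) / fact k) holomorphic_on D" for n
    unfolding trace_def by (intro holomorphic_intros pw) auto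
  fix z0 assume "z0 \<in> D"
  then obtain d where d: "d > 0" "cball z0 d \<subseteq> D" using D open_contains_cball by blast
  have "\<exists>M. \<forall>z\<in>cball z0 d. norm (Z z $ i $ j) \<le> M" for i j
  proof -
    have "continuous_on (cball z0 d) (\<lambda>z. Z z $ i $ j)"
      using holomorphic_on_imp_continuous_on[OF Z] d(2) continuous_on_subset by blast
    then have "bounded ((\<lambda>z. Z z $ i $ j) ` cball z0 d)"
      by (intro compact_imp_bounded compact_continuous_image compact_cball)
    then show ?thesis unfolding bounded_iff by auto
  qed
  then obtain B where B: "\<And>i j z. z \<in> cball z0 d \<Longrightarrow> norm (Z z $ i $ j) \<le> B i j" by metis
  define M where "M = (\<Sum>i\<in>UNIV. \<Sum>j\<in>UNIV. \<bar>B i j\<bar>)"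
  have BM: "B i j \<le> M" for i j
  proof -
    have "B i j \<le> \<bar>B i j\<bar>" by simp
    also have "\<dots> \<le> (\<Sum>j\<in>UNIV. \<bar>B i j\<bar>)" by (rule member_le_sum) auto
    also have "\<dots> \<le> M" unfolding M_def
      by (rule member_le_sum[where f = "\<lambda>i. \<Sum>j\<in>UNIV. \<bar>B i j\<bar>"]) (auto intro: sum_nonneg)
    finally show ?thesis .
  qed
  have ZM: "norm (Z z $ i $ j) \<le> M" if "z \<in> cball z0 d" for z i j
    using B[OF that, of i j] BM[of i j] by linarith
  have "uniform_limit (cball z0 d) (\<lambda>n z. \<Sum>k<n. trace (mpow (Z z) k) / fact k) (\<lambda>z. texp (Z z)) sequentially"
    unfolding texp_def
  proof (rule Weierstrass_m_test)
    show "summable (\<lambda>k. real CARD('n) * (inverse (fact k) * (real CARD('n) * M) ^ k))"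
      by (intro summable_mult summable_exp)
    fix k z assume z: "z \<in> cball z0 d"
    have "norm (trace (mpow (Z z) k)) \<le> (\<Sum>i\<in>(UNIV::'n set). (real CARD('n) * M) ^ k)"
      unfolding trace_def by (intro sum_norm_le norm_mpow_entry_le ZM z)
    then have "norm (trace (mpow (Z z) k)) / fact k \<le> (real CARD('n) * (real CARD('n) * M) ^ k) / fact k"
      by (intro divide_right_mono) auto
    also have "\<dots> = real CARD('n) * (inverse (fact k) * (real CARD('n) * M) ^ k)"
      by (simp only: divide_inverse mult_ac)
    finally show "norm (trace (mpow (Z z) k) / fact k) \<le> real CARD('n) * (inverse (fact k) * (real CARD('n) * M) ^ k)"
      by (simp add: norm_divide)
  qed
  then show "\<exists>d>0. cball z0 d \<subseteq> D \<and> uniform_limit (cball z0 d) (\<lambda>n z. \<Sum>k<n. trace (mpow (Z z) k) / fact k) (\<lambda>z. texp (Z z)) sequentially"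
    using d by blast
qed

section \<open>Agreement of \<open>clog\<close> with the real matrix logarithm\<close>

lemma cmat_mult_cvec: "cmat A *v cvec v = cvec (A *v v)"
  by (simp add: cmat_def cvec_def matrix_vector_mult_def vec_eq_iff)

lemma cvec_scaleR: "cvec (c *\<^sub>R v) = of_real c *s cvec v"
  by (simp add: cvec_def vec_eq_iff)

text \<open>The real span of \<open>E\<close> contains the coordinate vectors, which pick out the
  columns. Thus real eigenvectors suffice to identify complex matrices.\<close>

lemma complex_matrix_eqI:
  fixes M M' :: "complex^'n^'n"
  assumes E: "span E = UNIV" and eq: "\<And>v. v \<in> E \<Longrightarrow> M *v cvec v = M' *v cvec v"
  shows "M = M'"
proof -
  have lin: "linear (\<lambda>v. N *v cvec v)" for N :: "complex^'n^'n"
    by (rule linearI)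
       (simp_all add: vec_eq_iff matrix_vector_mult_def cvec_def algebra_simps sum.distrib scaleR_sum_right mult_scaleR_right flip: scaleR_conv_of_real)
  have all: "M *v cvec v = M' *v cvec v" for v
    using linear_eq_on_span[OF lin lin, of E M M' v] E eq by auto
  have col: "(N *v cvec (axis j 1)) $ i = N $ i $ j" for N :: "complex^'n^'n" and i j
    by (simp add: matrix_vector_mult_def cvec_def axis_def if_distrib cong: if_cong)
  show ?thesis unfolding vec_eq_iff using all col by metis
qed

lemma pencil_of_real: "pencil P Q (of_real x) = cmat (P + x *\<^sub>R Q)"
  by (simp add: pencil_def cmat_def vec_eq_iff)

lemma pos_def_mat_slit_regular:
  assumes "pos_def_mat C"
  shows "slit_regular (cmat C)"
proof -
  have "symmetric_mat (0 :: real^'n^'n)" by (simp add: symmetric_mat_def transpose_def vec_eq_iff)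
  \<comment> \<open>The constant pencil; the negative slit end makes the parameter \<open>0\<close>
    admissible.\<close>
  then have "admissible_pencil C 0 (-1)"
    using assms by (auto simp: admissible_pencil_def pos_semidef_mat_def pos_def_mat_def)
  moreover have "of_real 0 \<in> slit (-1)" unfolding mem_slit_iff by simp
  ultimately have "slit_regular (pencil C 0 (of_real 0))" by (rule slit_regular_pencil)
  then show ?thesis unfolding pencil_of_real by simp
qed

lemma clog_cmat_eigenvector:
  assumes C: "pos_def_mat C" and v: "C *v v = c *\<^sub>R v"
  shows "clog (cmat C) *v cvec v = of_real (ln c) *s cvec v"
proof (cases "v = 0")
  case True
  then show ?thesis by (simp add: cvec_def vec_eq_iff matrix_vector_mult_def)
next
  case False
  have "v \<bullet> (C *v v) > 0" using C False by (simp add: pos_def_mat_def)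
  then have "c > 0" using False zero_less_mult_pos2[of c "v \<bullet> v"] by (simp add: v)
  moreover have "cmat C *v cvec v = of_real c *s cvec v" by (simp add: cmat_mult_cvec v cvec_scaleR)
  ultimately show ?thesis by (intro clog_eigenvector pos_def_mat_slit_regular C)
qed

text \<open>An eigenvector of \<open>H\<close> for \<open>d\<close> is one of \<open>C\<close> for
  \<open>exp d\<close>, on which \<open>clog\<close> acts as \<open>ln (exp d) = d\<close>. This
  gives uniqueness of the symmetric logarithm.\<close>

lemma eq_clog_of_mat_exp_eq:
  assumes C: "pos_def_mat C" and H: "symmetric_mat H" "mat_exp H = C"
  shows "cmat H = clog (cmat C)"
proof (rule complex_matrix_eqI[OF symmetric_mat_eigenvectors_span[OF H(1)]])
  fix v assume "v \<in> {v. \<exists>c. H *v v = c *\<^sub>R v}"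
  then obtain d where d: "H *v v = d *\<^sub>R v" by blast
  then have "C *v v = exp d *\<^sub>R v" using mat_exp_eigenvector H(2) by blast
  from clog_cmat_eigenvector[OF C this]
  show "cmat H *v cvec v = clog (cmat C) *v cvec v" by (simp add: cmat_mult_cvec d cvec_scaleR)
qed

text \<open>Transposing the integrand swaps its two symmetric factors, which commute.\<close>

lemma transpose_clog_cmat:
  assumes C: "pos_def_mat C"
  shows "clog (cmat C) $ i $ j = clog (cmat C) $ j $ i"
proof -
  note reg = pos_def_mat_slit_regular[OF C]
  have tC: "transpose (cmat C) = cmat C"
    using symmetric_mat_entry[of C] C by (simp add: pos_def_mat_def transpose_def cmat_def vec_eq_iff)
  have "clog_integrand (cmat C) s $ i $ j = clog_integrand (cmat C) s $ j $ i" if s: "s \<in> {0..1}" for s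
  proof -
    let ?N = "segm (cmat C) s"
    have d: "det ?N \<noteq> 0" using reg s by (simp add: slit_regular_def)
    have t1: "transpose (cmat C - mat 1) = cmat C - mat 1"
      using tC by (simp add: transpose_def mat_def vec_eq_iff)
    then have tN: "transpose ?N = ?N"
      by (simp add: segm_def transpose_def mat_def vec_eq_iff)
    have "transpose (matrix_inv ?N) ** ?N = mat 1"
      by (metis d matrix_inv_det_nz(1) matrix_transpose_mul tN transpose_mat)
    then have "transpose (matrix_inv ?N) ** ?N ** matrix_inv ?N = matrix_inv ?N" by simp
    then have tinv: "transpose (matrix_inv ?N) = matrix_inv ?N"
      by (simp add: matrix_inv_det_nz[OF d] flip: matrix_mul_assoc)
    have "transpose (clog_integrand (cmat C) s) = clog_integrand (cmat C) s"
      using clog_integrand_commute[OF reg s] by (simp add: clog_integrand_def matrix_transpose_mul tinv t1)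
    then show ?thesis unfolding transpose_def by (metis vec_lambda_beta)
  qed
  then show ?thesis unfolding clog_def vec_lambda_beta by (rule integral_cong)
qed

text \<open>Take the entrywise real part of \<open>clog\<close>. It multiplies an eigenvector of
  \<open>C\<close> for \<open>c\<close> by \<open>ln c\<close>, so its exponential agrees with
  \<open>C\<close> on a spanning set.\<close>

lemma exists_mat_log:
  fixes C :: "real^'n^'n"
  assumes C: "pos_def_mat C"
  shows "\<exists>H. symmetric_mat H \<and> mat_exp H = C"
proof -
  define H :: "real^'n^'n" where "H = (\<chi> i j. Re (clog (cmat C) $ i $ j))"
  have "symmetric_mat H"
    unfolding symmetric_mat_def transpose_def H_def using transpose_clog_cmat[OF C] by (simp add: vec_eq_iff)
  moreover have "mat_exp H = C"
  proof -
    have "mat_exp H *v v = C *v v" if "v \<in> {v. \<exists>c. C *v v = c *\<^sub>R v}" for v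
    proof (cases "v = 0")
      case False
      from that obtain c where c: "C *v v = c *\<^sub>R v" by auto
      have "v \<bullet> (C *v v) > 0" using C False by (simp add: pos_def_mat_def)
      then have c0: "c > 0" using False zero_less_mult_pos2[of c "v \<bullet> v"] by (simp add: c)
      have "H *v v = ln c *\<^sub>R v"
      proof (subst vec_eq_iff, intro allI)
        fix i
        have "(H *v v) $ i = Re ((clog (cmat C) *v cvec v) $ i)"
          by (simp add: H_def matrix_vector_mult_def cvec_def)
        then show "(H *v v) $ i = (ln c *\<^sub>R v) $ i"
          unfolding clog_cmat_eigenvector[OF C c] by (simp add: cvec_def)
      qed
      from mat_exp_eigenvector[OF this] show ?thesis using c0 c by simp
    qed simp
    moreover have "v \<in> span {v. \<exists>c. C *v v = c *\<^sub>R v}" for v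
      using symmetric_mat_eigenvectors_span[of C] C unfolding pos_def_mat_def by blast
    ultimately have "mat_exp H *v v = C *v v" for v
      by (rule linear_eq_on_span[OF matrix_vector_mul_linear matrix_vector_mul_linear])
    then show ?thesis by (simp add: matrix_eq)
  qed
  ultimately show ?thesis by blast
qed

lemma cmat_mat_log:
  assumes C: "pos_def_mat C"
  shows "cmat (mat_log C) = clog (cmat C)"
proof -
  have inj: "H = H'" if "cmat H = cmat H'" for H H' :: "real^'n^'n"
    using that by (simp add: cmat_def vec_eq_iff)
  have "\<exists>!H. symmetric_mat H \<and> mat_exp H = C"
    using exists_mat_log[OF C] eq_clog_of_mat_exp_eq[OF C] inj by metis
  then have "symmetric_mat (mat_log C) \<and> mat_exp (mat_log C) = C"
    unfolding mat_log_def by (rule theI')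
  then show ?thesis using eq_clog_of_mat_exp_eq[OF C] by blast
qed

subsection \<open>Inversion of the pencil parameter\<close>

lemma pos_def_mat_add_psd:
  assumes "pos_def_mat P" "pos_semidef_mat Q" "x \<ge> 0"
  shows "pos_def_mat (P + x *\<^sub>R Q)"
proof -
  have "symmetric_mat (P + x *\<^sub>R Q)"
    using assms by (simp add: pos_def_mat_def pos_semidef_mat_def symmetric_mat_def transpose_def vec_eq_iff)
  moreover have "v \<bullet> ((P + x *\<^sub>R Q) *v v) > 0" if "v \<noteq> 0" for v
    using assms that
    by (simp add: matrix_vector_mult_add_rdistrib scaleR_matrix_vector_mult inner_add_right
        pos_def_mat_def pos_semidef_mat_def add_pos_nonneg)
  ultimately show ?thesis by (simp add: pos_def_mat_def)
qed

lemma pos_def_mat_scaleR: "pos_def_mat P \<Longrightarrow> x > 0 \<Longrightarrow> pos_def_mat (x *\<^sub>R P)"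
  by (simp add: pos_def_mat_def symmetric_mat_def transpose_def vec_eq_iff scaleR_matrix_vector_mult)

lemma pos_def_imp_pos_semidef: "pos_def_mat P \<Longrightarrow> pos_semidef_mat P"
  unfolding pos_def_mat_def pos_semidef_mat_def
  by (metis inner_zero_left less_eq_real_def)

text \<open>The swapped pencil appears after factoring out the parameter:
  \<open>P + z Q = z (Q + P / z)\<close>.\<close>

lemma admissible_pencil_0:
  assumes "pos_def_mat P" "pos_semidef_mat Q"
  shows "admissible_pencil P Q 0" "admissible_pencil Q P 0"
proof -
  show "admissible_pencil P Q 0"
    using assms pos_def_mat_add_psd[OF assms] by (auto simp: admissible_pencil_def pos_def_mat_def)
  have "pos_def_mat (Q + x *\<^sub>R P)" if "x > 0" for x
    using pos_def_mat_add_psd[OF pos_def_mat_scaleR[OF assms(1) that] assms(2), of 1] by (simp add: add.commute)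
  then show "admissible_pencil Q P 0"
    using assms pos_def_imp_pos_semidef by (auto simp: admissible_pencil_def pos_semidef_mat_def)
qed

lemma inverse_in_slit_0: "z \<in> slit 0 \<Longrightarrow> 1 / z \<in> slit 0"
  unfolding mem_slit_iff by (cases "Im z = 0") (auto simp: Im_divide Re_divide power2_eq_square)

text \<open>On the positive axis this is \<open>log (x B) = log x + log B\<close>; the rest of the slit plane is
  reached by analytic continuation.\<close>
lemma clog_pencil_inversion:
  fixes P Q :: "real^'n^'n"
  assumes P: "pos_def_mat P" and Q: "pos_semidef_mat Q" and z: "z \<in> slit 0"
  shows "clog (pencil P Q z) = mat (Ln z) + clog (pencil Q P (1 / z))"
proof -
  note adm = admissible_pencil_0[OF P Q]
  define f where "f i j z = clog (pencil P Q z) $ i $ j - (mat (Ln z) + clog (pencil Q P (1 / z))) $ i $ j" for i j z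
  have hol: "f i j holomorphic_on slit 0" for i j
  proof -
    have "Ln holomorphic_on slit 0"
      by (rule holomorphic_on_Ln) (auto simp: complex_nonpos_Reals_iff image_iff complex_eq_iff)
    then have "(\<lambda>z. (mat (Ln z) :: complex^'n^'n) $ i $ j) holomorphic_on slit 0"
      by (cases "i = j") (auto simp: mat_def)
    moreover have inv: "((\<lambda>z. clog (pencil Q P z) $ i $ j) \<circ> (\<lambda>z. 1 / z)) holomorphic_on slit 0"
    proof (rule holomorphic_on_compose_gen)
      show "(\<lambda>z. 1 / z) holomorphic_on slit 0" by (intro holomorphic_intros) auto
      show "(\<lambda>z. clog (pencil Q P z) $ i $ j) holomorphic_on slit 0"
        by (rule clog_pencil_holomorphic[OF adm(2)])
      show "(\<lambda>z. 1 / z) ` slit 0 \<subseteq> slit 0" by (rule image_subsetI) (rule inverse_in_slit_0)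
    qed
    ultimately show ?thesis unfolding f_def vector_add_component
      by (intro holomorphic_on_diff holomorphic_on_add clog_pencil_holomorphic[OF adm(1)]) (simp_all only: o_def)
  qed
  have real: "clog (pencil P Q (of_real x)) = mat (Ln (of_real x)) + clog (pencil Q P (1 / of_real x))"
    if x: "x > 0" for x :: real
  proof -
    define A where "A = P + x *\<^sub>R Q"
    define B where "B = Q + (1 / x) *\<^sub>R P"
    have A: "pos_def_mat A" and B: "pos_def_mat B"
      using adm x by (auto simp: A_def B_def admissible_pencil_def)
    \<comment> \<open>\<open>A\<close> and \<open>B\<close> share eigenvectors, with eigenvalues
      \<open>c\<close> and \<open>c / x\<close>.\<close>
    have BA: "B = (1 / x) *\<^sub>R A" using x by (simp add: A_def B_def vec_eq_iff field_simps)
    have "clog (cmat A) = mat (of_real (ln x)) + clog (cmat B)"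
    proof (rule complex_matrix_eqI[OF symmetric_mat_eigenvectors_span])
      show "symmetric_mat A" using A by (simp add: pos_def_mat_def)
      fix v assume "v \<in> {v. \<exists>c. A *v v = c *\<^sub>R v}"
      then obtain c where c: "A *v v = c *\<^sub>R v" by auto
      have Bv: "B *v v = (c / x) *\<^sub>R v" using c by (simp add: BA scaleR_matrix_vector_mult)
      show "clog (cmat A) *v cvec v = (mat (of_real (ln x)) + clog (cmat B)) *v cvec v"
      proof (cases "v = 0")
        case True
        then show ?thesis by (simp add: cvec_def vec_eq_iff matrix_vector_mult_def)
      next
        case False
        have "v \<bullet> (A *v v) > 0" using A False by (simp add: pos_def_mat_def)
        then have "c > 0" using False zero_less_mult_pos2[of c "v \<bullet> v"] by (simp add: c)
        then have "ln c = ln x + ln (c / x)" using x by (simp add: ln_div)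
        then show ?thesis
          unfolding matrix_vector_mult_add_rdistrib clog_cmat_eigenvector[OF A c] clog_cmat_eigenvector[OF B Bv] mat_mult_vec
          by (simp only: of_real_add vec.scale_left_distrib)
      qed
    qed
    moreover have "pencil Q P (1 / of_real x) = cmat B"
      using pencil_of_real[of Q P "1 / x"] by (simp add: B_def)
    moreover have "Ln (of_real x) = of_real (ln x)" using x by (simp add: Ln_of_real)
    ultimately show ?thesis by (simp add: pencil_of_real A_def)
  qed
  have "f i j z = 0" for i j
  proof (rule analytic_continuation[OF hol open_slit _ _ _ _ _ z])
    show "connected (slit 0)"
      by (intro starlike_imp_connected starlike_slotted_complex_plane_left)
    show "complex_of_real ` {0<..} \<subseteq> slit 0" by auto
    show "1 \<in> slit 0" unfolding mem_slit_iff by simp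
    show "1 islimpt complex_of_real ` {0<..}"
      unfolding islimpt_approachable
    proof (intro allI impI)
      fix e :: real assume e: "e > 0"
      show "\<exists>x'\<in>complex_of_real ` {0<..}. x' \<noteq> 1 \<and> dist x' 1 < e"
      proof (intro bexI conjI)
        show "complex_of_real (1 + e / 2) \<noteq> 1" using e by (simp add: complex_eq_iff)
        have "complex_of_real (1 + e / 2) - 1 = of_real (e / 2)" by simp
        then show "dist (complex_of_real (1 + e / 2)) 1 < e"
          using e unfolding dist_norm by (simp only: norm_of_real)
        show "complex_of_real (1 + e / 2) \<in> complex_of_real ` {0<..}" using e by (intro imageI) simp
      qed
    qed
    show "f i j w = 0" if "w \<in> complex_of_real ` {0<..}" for w
      using that by (auto simp: f_def real)
  qed
  then show ?thesis by (simp add: f_def vec_eq_iff)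
qed

subsection \<open>The trace function on the upper half plane\<close>

text \<open>The matrix \<open>C2 - z K2\<close> is the pencil of \<open>C2\<close> and
  \<open>K2\<close> at \<open>- z\<close>, which keeps the direction positive semidefinite.\<close>

definition trace_exp_ext ::
  "real^'n^'n \<Rightarrow> real^'n^'n \<Rightarrow> real^'n^'n \<Rightarrow> real^'n^'n \<Rightarrow> real^'n^'n \<Rightarrow> complex \<Rightarrow> complex" where
  "trace_exp_ext L C1 K1 C2 K2 z = texp (cmat L + clog (pencil C1 K1 z) + clog (pencil C2 K2 (- z)))"

text \<open>Pairing the exponent with an eigenvector expresses the imaginary part of the eigenvalue
  through the two logarithms alone, because the symmetric \<open>L\<close> contributes a real
  number.\<close>

lemma Im_trace_exp_ext_divide_nonpos:
  fixes L C1 C2 K1 K2 :: "real^'n^'n"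
  assumes L: "symmetric_mat L" and C: "pos_def_mat C1" "pos_def_mat C2"
    and K: "pos_semidef_mat K1" "pos_semidef_mat K2" and z: "Im z > 0"
  shows "Im (trace_exp_ext L C1 K1 C2 K2 z / z) \<le> 0"
proof -
  note adm1 = admissible_pencil_0[OF C(1) K(1)] and adm2 = admissible_pencil_0[OF C(2) K(2)]
  define Z where "Z = cmat L + clog (pencil C1 K1 z) + clog (pencil C2 K2 (- z))"
  obtain l where l: "\<And>i::'n. \<exists>v. v \<noteq> 0 \<and> Z *v v = l i *s v" and tr: "texp Z = (\<Sum>i\<in>UNIV. exp (l i))"
    using texp_eq_sum_exp_eigenvalues[of Z] by blast
  have z0: "z \<noteq> 0" using z by auto
  have zs: "z \<in> slit 0" "- z \<in> slit 0" unfolding mem_slit_iff using z by auto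
  have Iminv: "Im (1 / z) < 0" using z by (simp add: Im_divide divide_neg_pos sum_power2_gt_zero_iff)
  have bounds: "Im (l i) \<le> Im (Ln z)" "Im (Ln z) - pi \<le> Im (l i)" for i
  proof -
    obtain v where v: "v \<noteq> 0" "Z *v v = l i *s v" using l by blast
    define n where "n = (\<Sum>i\<in>UNIV. (cmod (v $ i))\<^sup>2)"
    have n: "n > 0" unfolding n_def by (rule hip_self_pos[OF v(1)])
    have hv: "hip v v = of_real n" by (simp only: hip_self n_def)
    have "Im (hip (Z *v v) v) = Im (l i) * n" by (simp add: v(2) hip_smult_left hv)
    moreover have "Im (hip (Z *v v) v)
       = Im (hip (clog (pencil C1 K1 z) *v v) v) + Im (hip (clog (pencil C2 K2 (- z)) *v v) v)"
      by (simp add: Z_def matrix_vector_mult_add_rdistrib hip_add_left hip_cmat[OF L])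
    ultimately have sum: "Im (l i) * n
       = Im (hip (clog (pencil C1 K1 z) *v v) v) + Im (hip (clog (pencil C2 K2 (- z)) *v v) v)" by simp
    have a1: "Im (hip (clog (pencil C1 K1 z) *v v) v) \<ge> 0"
      by (rule Im_hip_clog_pencil_nonneg[OF adm1(1) z])
    have a2: "Im (hip (clog (pencil C2 K2 (- z)) *v v) v) \<le> 0"
      by (rule Im_hip_clog_pencil_nonpos[OF adm2(1)]) (use z in simp)
    have b1: "Im (hip (clog (pencil K1 C1 (1 / z)) *v v) v) \<le> 0"
      by (rule Im_hip_clog_pencil_nonpos[OF adm1(2) Iminv])
    have "Im (1 / (- z)) > 0" using Iminv by simp
    then have b2: "Im (hip (clog (pencil K2 C2 (1 / (- z))) *v v) v) \<ge> 0"
      by (rule Im_hip_clog_pencil_nonneg[OF adm2(2)])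
    have c1: "Im (hip (clog (pencil C1 K1 z) *v v) v)
        = Im (Ln z) * n + Im (hip (clog (pencil K1 C1 (1 / z)) *v v) v)"
      unfolding clog_pencil_inversion[OF C(1) K(1) zs(1)]
      by (simp add: matrix_vector_mult_add_rdistrib hip_add_left mat_mult_vec hip_smult_left hv)
    have c2: "Im (hip (clog (pencil C2 K2 (- z)) *v v) v)
        = Im (Ln (- z)) * n + Im (hip (clog (pencil K2 C2 (1 / (- z))) *v v) v)"
      unfolding clog_pencil_inversion[OF C(2) K(2) zs(2)]
      by (simp add: matrix_vector_mult_add_rdistrib hip_add_left mat_mult_vec hip_smult_left hv)
    \<comment> \<open>For \<open>z\<close> in the upper half plane the argument of
      \<open>- z\<close> is that of \<open>z\<close> minus \<open>pi\<close>.\<close>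
    have lm: "Im (Ln (- z)) = Im (Ln z) - pi" using z z0 by (subst Ln_minus) auto
    \<comment> \<open>The upper bound inverts the first pencil and keeps the second; the lower bound
      below does the opposite.\<close>
    have "Im (l i) * n \<le> Im (Ln z) * n" using sum c1 b1 a2 by linarith
    then show "Im (l i) \<le> Im (Ln z)" using n by simp
    have "(Im (Ln z) - pi) * n \<le> Im (l i) * n" using sum c2 b2 a1 lm by simp
    then show "Im (Ln z) - pi \<le> Im (l i)" using n by simp
  qed
  have "trace_exp_ext L C1 K1 C2 K2 z / z = (\<Sum>i\<in>UNIV. exp (l i - Ln z))"
    using z0 by (simp add: trace_exp_ext_def Z_def[symmetric] tr sum_divide_distrib exp_diff)
  moreover have "Im (exp (l i - Ln z)) \<le> 0" for i
  proof -
    \<comment> \<open>The two bounds place this angle in the interval from \<open>0\<close> to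
      \<open>pi\<close>.\<close>
    have "sin (Im (Ln z) - Im (l i)) \<ge> 0" using bounds[of i] by (intro sin_ge_zero) linarith+
    moreover have "sin (Im (l i) - Im (Ln z)) = - sin (Im (Ln z) - Im (l i))"
      by (metis minus_diff_eq sin_minus)
    ultimately show ?thesis by (simp add: Im_exp mult_nonneg_nonpos)
  qed
  ultimately show ?thesis by (simp add: Im_sum sum_nonpos)
qed

section \<open>Real parameters near 0 and concavity\<close>

text \<open>On the unit sphere the form of \<open>C\<close> has a positive minimum \<open>m\<close>
  and that of \<open>K\<close> a finite maximum \<open>M\<close>, so a small negative multiple of
  \<open>K\<close> cannot destroy definiteness.\<close>

lemma exists_pos_def_interval:
  fixes C K :: "real^'n^'n"
  assumes C: "pos_def_mat C" and K: "pos_semidef_mat K"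
  shows "\<exists>e>0. admissible_pencil C K (- e)"
proof -
  have bl: "bounded_linear ((*v) A)" for A :: "real^'n^'n" by simp
  have cont: "continuous_on X (\<lambda>x. x \<bullet> (A *v x))" for X and A :: "real^'n^'n"
    by (intro continuous_on_inner continuous_on_id linear_continuous_on bl)
  have ne: "axis undefined 1 \<in> sphere (0::real^'n) 1" by simp
  obtain u where u: "u \<in> sphere (0::real^'n) 1" "\<And>y. y \<in> sphere 0 1 \<Longrightarrow> u \<bullet> (C *v u) \<le> y \<bullet> (C *v y)"
    using continuous_attains_inf[OF compact_sphere _ cont, of "0::real^'n" 1 C] ne by blast
  obtain w where w: "\<And>y. y \<in> sphere (0::real^'n) 1 \<Longrightarrow> y \<bullet> (K *v y) \<le> w \<bullet> (K *v w)"
    using continuous_attains_sup[OF compact_sphere _ cont, of "0::real^'n" 1 K] ne by blast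
  define m where "m = u \<bullet> (C *v u)"
  define M where "M = w \<bullet> (K *v w)"
  have "u \<noteq> 0" using u(1) by auto
  then have m: "m > 0" using C by (simp add: m_def pos_def_mat_def)
  have M: "M \<ge> 0" using K by (auto simp: M_def pos_semidef_mat_def)
  \<comment> \<open>Adding 1 avoids division by zero and makes \<open>e * M < m\<close>
    strict.\<close>
  define e where "e = m / (M + 1)"
  have e: "e > 0" using m M by (simp add: e_def)
  have eM: "e * M < m" using m M by (simp add: e_def field_simps)
  have sym: "symmetric_mat C" "symmetric_mat K" using C K by (auto simp: pos_def_mat_def pos_semidef_mat_def)
  have "pos_def_mat (C + x *\<^sub>R K)" if x: "x > - e" for x
  proof -
    have "v \<bullet> ((C + x *\<^sub>R K) *v v) > 0" if v: "v \<noteq> 0" for v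
    proof -
      define y where "y = (1 / norm v) *\<^sub>R v"
      have y: "y \<in> sphere 0 1" using v by (simp add: y_def)
      have "y \<bullet> (K *v y) \<ge> 0" using K by (simp add: pos_semidef_mat_def)
      then have "x * (y \<bullet> (K *v y)) \<ge> - e * (y \<bullet> (K *v y))" using x by (intro mult_right_mono) auto
      moreover have "e * (y \<bullet> (K *v y)) \<le> e * M" unfolding M_def using e by (intro mult_left_mono w y) auto
      moreover have "y \<bullet> (C *v y) \<ge> m" unfolding m_def by (rule u(2)[OF y])
      ultimately have "y \<bullet> (C *v y) + x * (y \<bullet> (K *v y)) > 0" using eM by linarith
      then have "y \<bullet> ((C + x *\<^sub>R K) *v y) > 0"
        by (simp add: matrix_vector_mult_add_rdistrib scaleR_matrix_vector_mult inner_add_right)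
      moreover have "y \<bullet> ((C + x *\<^sub>R K) *v y) = v \<bullet> ((C + x *\<^sub>R K) *v v) / (norm v)\<^sup>2"
        by (simp add: y_def matrix_vector_mult_scaleR power2_eq_square)
      ultimately show ?thesis using v by (simp add: zero_less_divide_iff)
    qed
    moreover have "symmetric_mat (C + x *\<^sub>R K)"
      using sym by (simp add: symmetric_mat_def transpose_def vec_eq_iff)
    ultimately show ?thesis by (simp add: pos_def_mat_def)
  qed
  then show ?thesis using e sym K by (auto simp: admissible_pencil_def)
qed

lemma trace_exp_ext_holomorphic:
  assumes "admissible_pencil C1 K1 (- e)" "admissible_pencil C2 K2 (- e)"
  shows "trace_exp_ext L C1 K1 C2 K2 holomorphic_on (slit (- e) \<inter> uminus ` slit (- e))"
proof -
  have open_neg: "open (uminus ` slit (- e))" by (rule open_negations[OF open_slit])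
  have "((\<lambda>z. clog (pencil C2 K2 z) $ i $ j) \<circ> uminus) holomorphic_on (uminus ` slit (- e))" for i j
    by (rule holomorphic_on_compose_gen[OF _ clog_pencil_holomorphic[OF assms(2)]])
       (auto intro!: holomorphic_intros)
  then have "(\<lambda>z. clog (pencil C2 K2 (- z)) $ i $ j) holomorphic_on (slit (- e) \<inter> uminus ` slit (- e))" for i j
    unfolding o_def using holomorphic_on_subset[OF _ Int_lower2] by blast
  moreover have "(\<lambda>z. clog (pencil C1 K1 z) $ i $ j) holomorphic_on (slit (- e) \<inter> uminus ` slit (- e))" for i j
    by (rule holomorphic_on_subset[OF clog_pencil_holomorphic[OF assms(1)]]) blast
  ultimately show ?thesis
    unfolding trace_exp_ext_def using open_slit open_neg
    by (intro holomorphic_texp open_Int) (auto intro!: holomorphic_intros)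
qed

lemma trace_exp_ext_of_real:
  assumes "pos_def_mat (C1 + x *\<^sub>R K1)" "pos_def_mat (C2 - x *\<^sub>R K2)"
  shows "trace_exp_ext L C1 K1 C2 K2 (of_real x)
     = of_real (trace (mat_exp (L + mat_log (C1 + x *\<^sub>R K1) + mat_log (C2 - x *\<^sub>R K2))))"
proof -
  have cadd: "cmat (A + B) = cmat A + cmat B" for A B :: "real^'n^'n"
    by (simp add: cmat_def vec_eq_iff)
  have "pencil C2 K2 (- of_real x) = cmat (C2 - x *\<^sub>R K2)"
    using pencil_of_real[of C2 K2 "- x"] by simp
  then show ?thesis
    unfolding trace_exp_ext_def texp_cmat[symmetric] cadd
    by (simp add: pencil_of_real cmat_mat_log[OF assms(1)] cmat_mat_log[OF assms(2)])
qed

text \<open>Moves the base point from \<open>0\<close> to a real \<open>x\<close>, so that the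
  inequality at \<open>0\<close> yields one at every nearby point.\<close>

lemma trace_exp_ext_shift:
  "trace_exp_ext L (C1 + x *\<^sub>R K1) K1 (C2 - x *\<^sub>R K2) K2 z = trace_exp_ext L C1 K1 C2 K2 (of_real x + z)"
proof -
  have "pencil (C1 + x *\<^sub>R K1) K1 z = pencil C1 K1 (of_real x + z)"
    by (simp add: pencil_def vec_eq_iff distrib_right)
  moreover have "pencil (C2 - x *\<^sub>R K2) K2 (- z) = pencil C2 K2 (- (of_real x + z))"
    by (simp add: pencil_def vec_eq_iff left_diff_distrib)
  ultimately show ?thesis by (simp add: trace_exp_ext_def)
qed

theorem theorem3p5:
  fixes L C1 C2 K1 K2 :: "real^'n^'n"
  assumes "symmetric_mat L"
    and "pos_def_mat C1" and "pos_def_mat C2"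
    and "pos_semidef_mat K1" and "pos_semidef_mat K2"
  shows "\<exists>e>0. concave_on {-e<..<e}
           (\<lambda>z::real. trace (mat_exp (L + mat_log (C1 + z *\<^sub>R K1) + mat_log (C2 - z *\<^sub>R K2))))"
proof -
  obtain e1 where e1: "e1 > 0" "admissible_pencil C1 K1 (- e1)"
    using exists_pos_def_interval[OF assms(2,4)] by blast
  obtain e2 where e2: "e2 > 0" "admissible_pencil C2 K2 (- e2)"
    using exists_pos_def_interval[OF assms(3,5)] by blast
  define e where "e = min e1 e2"
  have e: "e > 0" using e1 e2 by (simp add: e_def)
  have adm: "admissible_pencil C1 K1 (- e)" "admissible_pencil C2 K2 (- e)"
    using e1 e2 by (auto simp: admissible_pencil_def e_def)
  define f where "f = (\<lambda>z::real. trace (mat_exp (L + mat_log (C1 + z *\<^sub>R K1) + mat_log (C2 - z *\<^sub>R K2))))"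
  define F where "F = trace_exp_ext L C1 K1 C2 K2"
  \<comment> \<open>The plane without the two real rays from \<open>e\<close> and \<open>- e\<close>
    outwards: it joins both half planes through the interval around \<open>0\<close>.\<close>
  define D where "D = slit (- e) \<inter> uminus ` slit (- e)"
  have D: "open D" unfolding D_def by (intro open_Int open_slit open_negations)
  have D_iff: "z \<in> D \<longleftrightarrow> Im z \<noteq> 0 \<or> \<bar>Re z\<bar> < e" for z
  proof -
    have "z \<in> uminus ` slit (- e) \<longleftrightarrow> - z \<in> slit (- e)" by (metis add.inverse_inverse imageE imageI)
    then show ?thesis unfolding D_def Int_iff mem_slit_iff by auto
  qed
  have F: "F holomorphic_on D" unfolding F_def D_def by (rule trace_exp_ext_holomorphic[OF adm])
  have pd: "pos_def_mat (C1 + x *\<^sub>R K1)" "pos_def_mat (C2 - x *\<^sub>R K2)" if "\<bar>x\<bar> < e" for x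
  proof -
    show "pos_def_mat (C1 + x *\<^sub>R K1)" using adm(1) that by (auto simp: admissible_pencil_def)
    have "- x > - e" using that by auto
    then have "pos_def_mat (C2 + (- x) *\<^sub>R K2)" using adm(2) unfolding admissible_pencil_def by blast
    then show "pos_def_mat (C2 - x *\<^sub>R K2)" by simp
  qed
  have Ff: "F (of_real x) = of_real (f x)" if "\<bar>x\<bar> < e" for x
    unfolding F_def f_def by (rule trace_exp_ext_of_real[OF pd[OF that]])
  have F': "deriv F holomorphic_on D" by (rule holomorphic_deriv[OF F D])
  have derivs: "DERIV f x :> Re (deriv F (of_real x))" "DERIV (\<lambda>x. Re (deriv F (of_real x))) x :> Re (deriv (deriv F) (of_real x))"
    "Re (deriv (deriv F) (of_real x)) \<le> 0" if x: "x \<in> {-e<..<e}" for x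
  proof -
    have xD: "of_real x \<in> D" using x by (auto simp: D_iff)
    have d: "DERIV (\<lambda>x. Re (G (of_real x))) x :> Re (deriv G (of_real x))" if "G holomorphic_on D" for G
      by (intro has_field_derivative_Re has_vector_derivative_real_field holomorphic_derivI[OF that D xD])
    have "DERIV f x :> Re (deriv F (of_real x)) \<longleftrightarrow> DERIV (\<lambda>x. Re (F (of_real x))) x :> Re (deriv F (of_real x))"
    \<comment> \<open>\<open>f\<close> agrees with the real part of \<open>F\<close> only on the
      interval, which is a neighbourhood of \<open>x\<close>.\<close>
    proof (rule DERIV_cong_ev[OF refl _ refl])
      have "\<forall>\<^sub>F y in nhds x. y \<in> {-e<..<e}" using x by (intro eventually_nhds_in_open) auto
      then show "\<forall>\<^sub>F y in nhds x. f y = Re (F (of_real y))"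
        by eventually_elim (simp add: Ff abs_less_iff)
    qed
    then show "DERIV f x :> Re (deriv F (of_real x))" using d[OF F] by simp
    show "DERIV (\<lambda>x. Re (deriv F (of_real x))) x :> Re (deriv (deriv F) (of_real x))" by (rule d[OF F'])
    define G where "G = (\<lambda>z. F (of_real x + z))"
    define E where "E = (\<lambda>z. of_real x + z) -` D"
    have E: "open E" unfolding E_def using D by (intro open_vimage continuous_intros) auto
    have "((\<lambda>z. F z) \<circ> (\<lambda>z. of_real x + z)) holomorphic_on E"
      by (rule holomorphic_on_compose_gen[OF _ F]) (auto simp: E_def intro!: holomorphic_intros)
    then have G: "G holomorphic_on E" by (simp add: G_def o_def)
    have "Re (deriv (deriv G) 0) \<le> 0"
    proof (rule second_deriv_nonpos_of_Im_divide_nonpos[OF G E])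
      show "{z. Im z > 0} \<subseteq> E" by (auto simp: E_def D_iff)
      \<comment> \<open>The distance from \<open>x\<close> to the nearer end of the interval; discs
        of this radius around \<open>x\<close> avoid the removed rays.\<close>
      show "ball 0 (e - \<bar>x\<bar>) \<subseteq> E"
      proof
        fix z :: complex assume "z \<in> ball 0 (e - \<bar>x\<bar>)"
        then have "\<bar>Re z\<bar> < e - \<bar>x\<bar>" using abs_Re_le_cmod[of z] by simp
        then show "z \<in> E" by (auto simp: E_def D_iff)
      qed
      show "e - \<bar>x\<bar> > 0" using x by auto
      show "Im (G (of_real y)) = 0" if "\<bar>y\<bar> < e - \<bar>x\<bar>" for y
      proof -
        have "\<bar>x + y\<bar> < e" using that by linarith
        then show ?thesis using Ff[of "x + y"] by (simp add: G_def)
      qed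
      show "Im (G z / z) \<le> 0" if "Im z > 0" for z
        \<comment> \<open>After the shift \<open>C1 + x K1\<close> and \<open>C2 - x K2\<close> take
          the places of \<open>C1\<close> and \<open>C2\<close>; both are positive definite for
          \<open>x\<close> in the interval.\<close>
        unfolding G_def F_def trace_exp_ext_shift[symmetric]
        by (rule Im_trace_exp_ext_divide_nonpos) (use assms pd x that in auto)
    qed
    moreover have "deriv (deriv G) 0 = deriv (deriv F) (of_real x)"
    proof -
      have shift: "((\<lambda>z. H (of_real x + z)) has_field_derivative deriv H (of_real x + z)) (at z)"
        if "H holomorphic_on D" "z \<in> E" for H z
      proof -
        have "(H has_field_derivative deriv H (of_real x + z)) (at (of_real x + z))"
          using that by (intro holomorphic_derivI[OF that(1) D]) (simp add: E_def)
        then have "((\<lambda>z. H (of_real x + z)) has_field_derivative deriv H (of_real x + z) * 1) (at z)"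
          by (rule DERIV_chain2) (auto intro!: derivative_eq_intros)
        then show ?thesis by simp
      qed
      have dG: "deriv G z = deriv F (of_real x + z)" if "z \<in> E" for z
        unfolding G_def by (rule DERIV_imp_deriv[OF shift[OF F that]])
      have E0: "0 \<in> E" using xD by (simp add: E_def)
      have "((\<lambda>z. deriv F (of_real x + z)) has_field_derivative deriv (deriv F) (of_real x + 0)) (at 0)"
        by (rule shift[OF F' E0])
      then have "(deriv G has_field_derivative deriv (deriv F) (of_real x + 0)) (at 0)"
        by (rule has_field_derivative_transform_within_open[OF _ E E0]) (simp add: dG)
      then show ?thesis by (simp add: DERIV_imp_deriv)
    qed
    ultimately show "Re (deriv (deriv F) (of_real x)) \<le> 0" by simp
  qed
  have "concave_on {-e<..<e} f"
    by (rule f''_le0_imp_concave[where f' = "\<lambda>x. Re (deriv F (of_real x))" and f'' = "\<lambda>x. Re (deriv (deriv F) (of_real x))"])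
       (use derivs in auto)
  then show ?thesis using e unfolding f_def by blast
qed

end
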